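(* Assume that ${\rm conv}(A)$ is a simplex and that $w\in\mathbf R^n$ is a generic weight vector such that the regular triangulation $\Delta_w$ is ${\rm conv}(A)$ itself. Let $\beta\in\mathbf k^d$. Then the fake indicial ideal $\widetilde{{\rm fin}}_w(H_A(\beta))$ is a radical ideal of $\mathbf k[\theta]$.
   Context: Let $\mathbf N=\{0,1,2,\dots\}$ and let $\mathbf k$ be a field of characteristic zero. Let $A=(a_1,\dots,a_n)=(a_{ij})$ be a $d\times n$ integer matrix of rank $d$ whose columns all lie on one hyperplane of $\mathbf Q^d$ not containing the origin; $A$ also denotes the set of its columns. $I_A=\langle \partial^u-\partial^v : u,v\in\mathbf N^n,\ Au=Av\rangle\subset\mathbf k[\partial]=\mathbf k[\partial_1,\dots,\partial_n]$. For $\beta\in\mathbf k^d$, $H_A(\beta)$ is the left ideal of the Weyl algebra $D=\mathbf k\langle x_1,\dots,x_n,\partial_1,\dots,\partial_n\rangle$ generated by $I_A$ and $\sum_{j}a_{ij}\theta_j-\beta_i$ ($i=1,\dots,d$), with $\theta_j=x_j\partial_j$. $\partial_j$ has $w$-weight $w_j$, and ${\rm in}_w(I_A)$ is the ideal generated by the initial forms (parts of highest $w$-weight) of elements of $I_A$. Generic means that the initial ideals ${\rm in}_w(I_A)$ and ${\rm in}_{(-w,w)}(H_A(\beta))$ do not change under small perturbations of $w$ (so ${\rm in}_w(I_A)$ is a monomial ideal). $\Delta_w$ is the regular triangulation of ${\rm conv}(A)$ determined by $w$: ${\rm conv}\{a_j : j\in I\}$ is a face of $\Delta_w$ with vertices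 $a_j$ ($j\in I$) iff there is $c\in\mathbf R^d$ with $c\cdot a_j=w_j$ for $j\in I$ and $c\cdot a_j<w_j$ for $j\notin I$; $\emptyset$ is also a face. "$\Delta_w$ is ${\rm conv}(A)$ itself" means that $\Delta_w$ consists of the simplex ${\rm conv}(A)$ and its faces. The fake indicial ideal is $\widetilde{{\rm fin}}_w(H_A(\beta))=(D\cdot{\rm in}_w(I_A)\cap\mathbf k[\theta])+\langle A\theta-\beta\rangle\subset\mathbf k[\theta]=\mathbf k[\theta_1,\dots,\theta_n]$, where $\langle A\theta-\beta\rangle$ is the ideal generated by $\sum_ja_{ij}\theta_j-\beta_i$ ($i=1,\dots,d$). *)

theory Defs
  imports "HOL-Analysis.Analysis" "HOL-Library.Poly_Mapping"
begin

section \<open>The Weyl algebra\<close>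

text \<open>
  An element of the Weyl algebra \<open>D = k\<langle>x\<^sub>j, \<partial>\<^sub>j\<rangle>\<close> (with one pair of generators for every index
  \<open>j\<close> in the finite type \<open>'n\<close>) is stored by its normally ordered expression: the coefficient at
  \<open>(a, b)\<close> is the coefficient of \<open>x\<^sup>a \<partial>\<^sup>b\<close>.
\<close>

typedef (overloaded) ('k, 'n) weyl =
  "UNIV :: (((nat ^ 'n) \<times> (nat ^ 'n)) \<Rightarrow>\<^sub>0 'k::zero) set"
  morphisms weyl_coeffs Weyl
  by simp

definition weyl_coeff :: "('k::zero, 'n::finite) weyl \<Rightarrow> nat ^ 'n \<Rightarrow> nat ^ 'n \<Rightarrow> 'k" where
  "weyl_coeff P a b = Poly_Mapping.lookup (weyl_coeffs P) (a, b)"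

definition weyl_supp :: "('k::zero, 'n::finite) weyl \<Rightarrow> ((nat ^ 'n) \<times> (nat ^ 'n)) set" where
  "weyl_supp P = Poly_Mapping.keys (weyl_coeffs P)"

definition weyl_monom :: "'k::zero \<Rightarrow> nat ^ 'n \<Rightarrow> nat ^ 'n \<Rightarrow> ('k, 'n::finite) weyl" where
  "weyl_monom c a b = Weyl (Poly_Mapping.single (a, b) c)"

lemma weyl_eqI: "(\<And>a b. weyl_coeff P a b = weyl_coeff Q a b) \<Longrightarrow> P = Q"
  by (auto simp: weyl_coeff_def weyl_coeffs_inject[symmetric] intro!: poly_mapping_eqI)

lemma finite_weyl_supp [simp]: "finite (weyl_supp P)"
  by (simp add: weyl_supp_def)

lemma in_weyl_supp_iff: "(a, b) \<in> weyl_supp P \<longleftrightarrow> weyl_coeff P a b \<noteq> 0"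
  by (simp add: weyl_supp_def weyl_coeff_def in_keys_iff)

lemma weyl_coeff_monom:
  "weyl_coeff (weyl_monom c a b) a' b' = (if a' = a \<and> b' = b then c else 0)"
  by (auto simp: weyl_coeff_def weyl_monom_def Weyl_inverse lookup_single when_def)

lemma weyl_supp_monom: "weyl_supp (weyl_monom c a b) \<subseteq> {(a, b)}"
  by (auto simp: in_weyl_supp_iff weyl_coeff_monom split: if_splits)

text \<open>
  The product is the bilinear extension of the Leibniz rule
  \<open>x\<^sup>a \<partial>\<^sup>b \<cdot> x\<^sup>c \<partial>\<^sup>d = (\<Sum>k. (\<Prod>j. k\<^sub>j! (b\<^sub>j choose k\<^sub>j) (c\<^sub>j choose k\<^sub>j)) x\<^bsup>a+c-k\<^esup> \<partial>\<^bsup>b+d-k\<^esup>)\<close>.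
\<close>

definition weyl_monom_times ::
  "'k::field_char_0 \<Rightarrow> nat ^ 'n \<Rightarrow> nat ^ 'n \<Rightarrow> nat ^ 'n \<Rightarrow> nat ^ 'n
    \<Rightarrow> (((nat ^ 'n) \<times> (nat ^ 'n)) \<Rightarrow>\<^sub>0 'k)" where
  "weyl_monom_times s a b c d =
    (\<Sum>k | \<forall>j. k $ j \<le> b $ j \<and> k $ j \<le> c $ j.
      Poly_Mapping.single (a + c - k, b + d - k)
        (s * (\<Prod>j\<in>UNIV. fact (k $ j) * of_nat (b $ j choose k $ j) * of_nat (c $ j choose k $ j))))"

text \<open>
  The ring axioms are verified on the faithful action of \<open>D\<close> on Laurent series
  \<open>f = (\<Sum>m. f m x\<^sup>m)\<close> without any support condition, where
  \<open>x\<^sup>a \<partial>\<^sup>b x\<^sup>m = (\<Prod>j. m\<^sub>j (m\<^sub>j - 1) \<cdots> (m\<^sub>j - b\<^sub>j + 1)) x\<^bsup>m-b+a\<^esup>\<close>.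
\<close>

definition ivec :: "nat ^ 'n \<Rightarrow> int ^ 'n" where
  "ivec a = (\<chi> j. int (a $ j))"

definition ffall :: "int ^ 'n \<Rightarrow> nat ^ 'n \<Rightarrow> 'k::field_char_0" where
  "ffall z b = (\<Prod>j\<in>UNIV. fact (b $ j) * ((of_int (z $ j)) gchoose (b $ j)))"

definition pm_act :: "(((nat ^ 'n) \<times> (nat ^ 'n)) \<Rightarrow>\<^sub>0 'k::field_char_0) \<Rightarrow> (int ^ 'n \<Rightarrow> 'k) \<Rightarrow> int ^ 'n \<Rightarrow> 'k" where
  "pm_act p f m = (\<Sum>(a, b)\<in>Poly_Mapping.keys p.
     Poly_Mapping.lookup p (a, b) * (ffall (m - ivec a + ivec b) b * f (m - ivec a + ivec b)))"

lemma pm_act_superset: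
  assumes "finite S" "Poly_Mapping.keys p \<subseteq> S"
  shows "pm_act p f m = (\<Sum>(a, b)\<in>S.
     Poly_Mapping.lookup p (a, b) * (ffall (m - ivec a + ivec b) b * f (m - ivec a + ivec b)))"
  unfolding pm_act_def using assms by (intro sum.mono_neutral_left) (auto simp: in_keys_iff)

lemma pm_act_add: "pm_act (p + q) f m = pm_act p f m + pm_act q f m"
proof -
  let ?S = "Poly_Mapping.keys p \<union> Poly_Mapping.keys q"
  have k: "Poly_Mapping.keys (p + q) \<subseteq> ?S" by (rule keys_add)
  show ?thesis
    unfolding pm_act_superset[of ?S "p + q", OF _ k, simplified]
      pm_act_superset[of ?S p, simplified] pm_act_superset[of ?S q, simplified]
      sum.distrib[symmetric]
    by (rule sum.cong) (auto simp: lookup_add distrib_right)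
qed

lemma pm_act_add_fun: "pm_act (p + q) f = (\<lambda>m. pm_act p f m + pm_act q f m)"
  by (rule ext) (rule pm_act_add)

lemma pm_act_zero [simp]: "pm_act 0 f m = 0"
  by (simp add: pm_act_def)

lemma pm_act_sum: "pm_act (\<Sum>i\<in>I. p i) f m = (\<Sum>i\<in>I. pm_act (p i) f m)"
  by (induction I rule: infinite_finite_induct) (auto simp: pm_act_add)

lemma pm_act_single:
  "pm_act (Poly_Mapping.single (a, b) c) f m
     = c * (ffall (m - ivec a + ivec b) b * f (m - ivec a + ivec b))"
  by (subst pm_act_superset[of "{(a, b)}"]) auto

lemma pm_act_fun_add: "pm_act p (\<lambda>z. f z + g z) m = pm_act p f m + pm_act p g m"
  unfolding pm_act_def sum.distrib[symmetric] by (rule sum.cong) (auto simp: algebra_simps)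

lemma ffall_0 [simp]: "ffall z 0 = 1"
  by (simp add: ffall_def)

lemma ivec_0 [simp]: "ivec 0 = 0"
  by (simp add: ivec_def vec_eq_iff)

lemma falling_split:
  fixes y :: "'k::field_char_0"
  shows "fact (d + e) * (y gchoose (d + e))
     = fact d * (y gchoose d) * (fact e * ((y - of_nat d) gchoose e))"
proof -
  have "(\<Prod>i = 0..<d + e. y - of_nat i)
      = (\<Prod>i = 0..<d. y - of_nat i) * (\<Prod>i = 0..<e. y - of_nat d - of_nat i)"
    by (induction e) (simp_all add: algebra_simps)
  then show ?thesis by (simp only: gbinomial_mult_fact)
qed

lemma leibniz_1:
  fixes y :: "'k::field_char_0"
  shows "(\<Sum>k\<le>min b c. fact k * of_nat (b choose k) * of_nat (c choose k)
            * (fact (b + d - k) * (y gchoose (b + d - k))))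
    = (fact b * ((y - of_nat d + of_nat c) gchoose b)) * (fact d * (y gchoose d))"
    (is "?L = ?R")
proof -
  have "?L = (\<Sum>k\<le>min b c. fact d * (y gchoose d) * fact b
      * (((of_nat c) gchoose k) * ((y - of_nat d) gchoose (b - k))))"
  proof (rule sum.cong)
    fix k assume "k \<in> {..min b c}"
    then have k: "k \<le> b" by simp
    then have e: "b + d - k = d + (b - k)" by simp
    have f: "fact k * of_nat (b choose k) * fact (b - k) = (fact b :: 'k)"
    proof -
      have "of_nat (fact k * fact (b - k) * (b choose k)) = (of_nat (fact b) :: 'k)"
        by (simp only: binomial_fact_lemma[OF k])
      then show ?thesis by (simp only: of_nat_mult of_nat_fact ac_simps)
    qed
    show "fact k * of_nat (b choose k) * of_nat (c choose k)
            * (fact (b + d - k) * (y gchoose (b + d - k)))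
       = fact d * (y gchoose d) * fact b
           * (((of_nat c) gchoose k) * ((y - of_nat d) gchoose (b - k)))"
      by (simp only: e falling_split f[symmetric] binomial_gbinomial[of c k] ac_simps)
  qed simp
  also have "\<dots> = (\<Sum>k = 0..b. fact d * (y gchoose d) * fact b
      * (((of_nat c) gchoose k) * ((y - of_nat d) gchoose (b - k))))"
    by (rule sum.mono_neutral_left)
       (auto simp: binomial_gbinomial[symmetric] binomial_eq_0)
  also have "\<dots> = ?R"
    unfolding sum_distrib_left[symmetric] gbinomial_Vandermonde by (simp add: algebra_simps)
  finally show ?thesis .
qed

lemma prod_sum_vec:
  fixes g :: "'n::finite \<Rightarrow> nat \<Rightarrow> 'k::comm_ring_1"
  shows "(\<Sum>k | \<forall>j. k $ j \<le> u $ j. \<Prod>j\<in>UNIV. g j (k $ j)) = (\<Prod>j\<in>UNIV. \<Sum>i\<le>u $ j. g j i)"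
proof -
  have "(\<Prod>j\<in>UNIV. \<Sum>i\<le>u $ j. g j i)
      = (\<Sum>h\<in>PiE UNIV (\<lambda>j. {..u $ j}). \<Prod>j\<in>UNIV. g j (h j))"
    by (rule prod_sum_PiE) auto
  also have "\<dots> = (\<Sum>k | \<forall>j. k $ j \<le> u $ j. \<Prod>j\<in>UNIV. g j (k $ j))"
    by (rule sum.reindex_bij_witness[of _ "\<lambda>k. ($) k" "\<lambda>h. \<chi> j. h j"]) auto
  finally show ?thesis by simp
qed

lemma leibniz_vec:
  fixes b c d :: "nat ^ 'n::finite"
  shows "(\<Sum>k | \<forall>j. k $ j \<le> b $ j \<and> k $ j \<le> c $ j.
      (\<Prod>j\<in>UNIV. fact (k $ j) * of_nat (b $ j choose k $ j) * of_nat (c $ j choose k $ j))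
        * ffall y (b + d - k))
    = (ffall (y - ivec d + ivec c) b * ffall y d :: 'k::field_char_0)"
proof -
  define u :: "nat ^ 'n" where "u = (\<chi> j. min (b $ j) (c $ j))"
  define g :: "'n \<Rightarrow> nat \<Rightarrow> 'k" where "g = (\<lambda>j i.
      fact i * of_nat (b $ j choose i) * of_nat (c $ j choose i)
        * (fact (b $ j + d $ j - i) * (of_int (y $ j) gchoose (b $ j + d $ j - i))))"
  have "(\<Sum>k | \<forall>j. k $ j \<le> b $ j \<and> k $ j \<le> c $ j.
      (\<Prod>j\<in>UNIV. fact (k $ j) * of_nat (b $ j choose k $ j) * of_nat (c $ j choose k $ j))
        * ffall y (b + d - k))
     = (\<Sum>k | \<forall>j. k $ j \<le> u $ j. \<Prod>j\<in>UNIV. g j (k $ j))"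
    by (rule sum.cong) (auto simp: u_def g_def ffall_def prod.distrib[symmetric])
  also have "\<dots> = (\<Prod>j\<in>UNIV. \<Sum>i\<le>u $ j. g j i)"
    by (rule prod_sum_vec)
  also have "\<dots> = ffall (y - ivec d + ivec c) b * ffall y d"
    unfolding ffall_def prod.distrib[symmetric]
    by (rule prod.cong) (simp_all add: u_def g_def leibniz_1 ivec_def)
  finally show ?thesis .
qed

lemma pm_act_monom_times:
  "pm_act (weyl_monom_times (s * t) a b c d) f m
    = s * (ffall (m - ivec a + ivec b) b
        * (t * (ffall (m - ivec a + ivec b - ivec c + ivec d) d
            * f (m - ivec a + ivec b - ivec c + ivec d))))"
proof -
  let ?y = "m - ivec a + ivec b - ivec c + ivec d"
  have shift: "m - ivec (a + c - k) + ivec (b + d - k) = ?y"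
    if "\<forall>j. k $ j \<le> b $ j \<and> k $ j \<le> c $ j" for k
    using that by (auto simp: vec_eq_iff ivec_def of_nat_diff trans_le_add1 trans_le_add2)
  have "pm_act (weyl_monom_times (s * t) a b c d) f m
    = (\<Sum>k | \<forall>j. k $ j \<le> b $ j \<and> k $ j \<le> c $ j.
        (s * t * f ?y) * ((\<Prod>j\<in>UNIV. fact (k $ j) * of_nat (b $ j choose k $ j)
            * of_nat (c $ j choose k $ j)) * ffall ?y (b + d - k)))"
    unfolding weyl_monom_times_def pm_act_sum pm_act_single
    by (rule sum.cong) (auto simp: shift)
  also have "\<dots> = s * t * f ?y * (ffall (?y - ivec d + ivec c) b * ffall ?y d)"
    by (simp only: sum_distrib_left[symmetric] leibniz_vec)
  finally show ?thesis by (simp add: ac_simps)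
qed

lemma ffall_eq_0:
  assumes "\<not> b j \<le> (e :: nat)" "b j = c $ j" "z $ j = int e"
  shows "ffall z c = (0 :: 'k::field_char_0)"
proof -
  have "(of_int (z $ j) gchoose (c $ j)) = (0 :: 'k)"
    using assms by (simp add: binomial_gbinomial[symmetric])
  then show ?thesis
    unfolding ffall_def by (intro prod_zero) auto
qed

lemma pm_act_faithful:
  assumes "pm_act p = pm_act q"
  shows "p = (q :: ((nat ^ 'n) \<times> (nat ^ 'n)) \<Rightarrow>\<^sub>0 'k::field_char_0)"
proof (rule ccontr)
  assume "p \<noteq> q"
  define r where "r = p - q"
  have "pm_act p f m = pm_act r f m + pm_act q f m" for f m
    unfolding pm_act_add[symmetric] r_def by simp
  then have r0: "pm_act r f m = 0" for f m using assms by simp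
  have "r \<noteq> 0" using \<open>p \<noteq> q\<close> by (simp add: r_def)
  then have "Poly_Mapping.keys r \<noteq> {}" by simp
  define sz :: "((nat ^ 'n) \<times> (nat ^ 'n)) \<Rightarrow> nat" where "sz = (\<lambda>(a, b). \<Sum>j\<in>UNIV. b $ j)"
  obtain a0 b0 where ab: "(a0, b0) \<in> Poly_Mapping.keys r"
    and min: "\<And>a b. (a, b) \<in> Poly_Mapping.keys r \<Longrightarrow> sz (a0, b0) \<le> sz (a, b)"
    using \<open>Poly_Mapping.keys r \<noteq> {}\<close> arg_min_if_finite[of "Poly_Mapping.keys r" sz]
    by (metis finite_keys linorder_not_le surj_pair)
  define f :: "int ^ 'n \<Rightarrow> 'k" where "f = (\<lambda>z. if z = ivec b0 then 1 else 0)"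
  have "0 = pm_act r f (ivec a0)" by (simp add: r0)
  also have "\<dots> = (\<Sum>(a, b)\<in>Poly_Mapping.keys r. if (a, b) = (a0, b0)
      then Poly_Mapping.lookup r (a0, b0) * ffall (ivec b0) b0 else 0)"
    unfolding pm_act_def
  proof (rule sum.cong, rule refl, clarify)
    fix a b assume in_r: "(a, b) \<in> Poly_Mapping.keys r"
    show "Poly_Mapping.lookup r (a, b) * (ffall (ivec a0 - ivec a + ivec b) b
           * f (ivec a0 - ivec a + ivec b))
       = (if (a, b) = (a0, b0) then Poly_Mapping.lookup r (a0, b0) * ffall (ivec b0) b0 else 0)"
    proof (cases "ivec a0 - ivec a + ivec b = ivec b0")
      case False
      then show ?thesis by (auto simp: f_def)
    next
      case eq: True
      show ?thesis
      proof (cases "\<forall>j. b $ j \<le> b0 $ j")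
        case True
        have "\<forall>j\<in>UNIV. b $ j = b0 $ j"
        proof (rule ccontr)
          assume "\<not> ?thesis"
          then obtain j where "b $ j < b0 $ j" using True by (meson le_neq_implies_less)
          then have "(\<Sum>j\<in>UNIV. b $ j) < (\<Sum>j\<in>UNIV. b0 $ j)"
            using True by (intro sum_strict_mono_ex1) auto
          then show False using min[OF in_r] by (simp add: sz_def)
        qed
        then have "b = b0" by (simp add: vec_eq_iff)
        moreover from this eq have "a = a0" by (simp add: vec_eq_iff ivec_def)
        ultimately show ?thesis by (simp add: f_def)
      next
        case False
        then obtain j where j: "\<not> b $ j \<le> b0 $ j" by auto
        have "ffall (ivec b0) b = (0 :: 'k)"
          by (rule ffall_eq_0[of "($) b" j "b0 $ j"]) (use j in \<open>auto simp: ivec_def\<close>)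
        then show ?thesis using eq j by auto
      qed
    qed
  qed
  also have "\<dots> = (\<Sum>x\<in>Poly_Mapping.keys r. if x = (a0, b0)
      then Poly_Mapping.lookup r (a0, b0) * ffall (ivec b0) b0 else 0)"
    by (simp only: case_prod_unfold prod.collapse)
  also have "\<dots> = Poly_Mapping.lookup r (a0, b0) * ffall (ivec b0) b0"
    using ab by simp
  finally have "Poly_Mapping.lookup r (a0, b0) * ffall (ivec b0) b0 = (0 :: 'k)" by simp
  moreover have "ffall (ivec b0) b0 \<noteq> (0 :: 'k)"
    by (simp add: ffall_def ivec_def binomial_gbinomial[symmetric])
  ultimately show False using ab by (simp add: in_keys_iff)
qed

instantiation weyl :: (field_char_0, finite) ring_1
begin

definition zero_weyl :: "('a, 'b) weyl" where "zero_weyl = Weyl 0"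

definition one_weyl :: "('a, 'b) weyl" where "one_weyl = weyl_monom 1 0 0"

definition plus_weyl :: "('a, 'b) weyl \<Rightarrow> ('a, 'b) weyl \<Rightarrow> ('a, 'b) weyl" where
  "plus_weyl P Q = Weyl (weyl_coeffs P + weyl_coeffs Q)"

definition minus_weyl :: "('a, 'b) weyl \<Rightarrow> ('a, 'b) weyl \<Rightarrow> ('a, 'b) weyl" where
  "minus_weyl P Q = Weyl (weyl_coeffs P - weyl_coeffs Q)"

definition uminus_weyl :: "('a, 'b) weyl \<Rightarrow> ('a, 'b) weyl" where
  "uminus_weyl P = Weyl (- weyl_coeffs P)"

definition times_weyl :: "('a, 'b) weyl \<Rightarrow> ('a, 'b) weyl \<Rightarrow> ('a, 'b) weyl" where
  "times_weyl P Q =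
    Weyl (\<Sum>(a, b)\<in>weyl_supp P. \<Sum>(c, d)\<in>weyl_supp Q.
      weyl_monom_times (weyl_coeff P a b * weyl_coeff Q c d) a b c d)"

lemma pm_act_times:
  fixes P Q :: "('a, 'b) weyl"
  shows "pm_act (weyl_coeffs (P * Q)) f m = pm_act (weyl_coeffs P) (pm_act (weyl_coeffs Q) f) m"
proof -
  have "pm_act (weyl_coeffs (P * Q)) f m
    = (\<Sum>s\<in>weyl_supp P. \<Sum>t\<in>weyl_supp Q.
        pm_act (weyl_monom_times (weyl_coeff P (fst s) (snd s) * weyl_coeff Q (fst t) (snd t))
          (fst s) (snd s) (fst t) (snd t)) f m)"
    by (simp only: times_weyl_def Weyl_inverse[OF UNIV_I] pm_act_sum case_prod_unfold)
  also have "\<dots> = pm_act (weyl_coeffs P) (pm_act (weyl_coeffs Q) f) m"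
    unfolding pm_act_def[of "weyl_coeffs P"] pm_act_def[of "weyl_coeffs Q"] pm_act_monom_times
      weyl_supp_def[symmetric] weyl_coeff_def[symmetric] case_prod_unfold sum_distrib_left ..
  finally show ?thesis .
qed

lemma pm_act_times_fun:
  "pm_act (weyl_coeffs (P * Q)) f = pm_act (weyl_coeffs P) (pm_act (weyl_coeffs Q) f)"
  by (rule ext) (rule pm_act_times)

lemma weyl_act_faithful:
  assumes "\<And>f m. pm_act (weyl_coeffs P) f m = pm_act (weyl_coeffs Q) f m"
  shows "P = (Q :: ('a, 'b) weyl)"
proof -
  have "weyl_coeffs P = weyl_coeffs Q"
    by (rule pm_act_faithful) (intro ext assms)
  then show ?thesis by (simp add: weyl_coeffs_inject)
qed

lemma weyl_coeffs_ops:
  "weyl_coeffs (0 :: ('a, 'b) weyl) = 0"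
  "weyl_coeffs (P + Q) = weyl_coeffs P + weyl_coeffs (Q :: ('a, 'b) weyl)"
  "weyl_coeffs (P - Q) = weyl_coeffs P - weyl_coeffs (Q :: ('a, 'b) weyl)"
  "weyl_coeffs (- Q) = - weyl_coeffs (Q :: ('a, 'b) weyl)"
  by (simp_all add: zero_weyl_def plus_weyl_def minus_weyl_def uminus_weyl_def Weyl_inverse)

lemma pm_act_one: "pm_act (weyl_coeffs (1 :: ('a, 'b) weyl)) f = f"
  by (simp add: fun_eq_iff one_weyl_def weyl_monom_def Weyl_inverse pm_act_single)

instance
proof
  fix P Q R :: "('a, 'b) weyl"
  show "P * Q * R = P * (Q * R)"
    by (rule weyl_act_faithful)
       (simp only: pm_act_times_fun)
  show "(P + Q) * R = P * R + Q * R"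
    by (rule weyl_act_faithful) (simp add: pm_act_times weyl_coeffs_ops pm_act_add)
  show "P * (Q + R) = P * Q + P * R"
    by (rule weyl_act_faithful)
       (simp only: pm_act_times_fun weyl_coeffs_ops pm_act_add pm_act_add_fun pm_act_fun_add)
  show "1 * P = P" "P * 1 = P"
    by (rule weyl_act_faithful; simp only: pm_act_times_fun pm_act_one)+
  have "weyl_coeffs (0 :: ('a, 'b) weyl) \<noteq> weyl_coeffs 1"
    by (simp add: weyl_coeffs_ops one_weyl_def weyl_monom_def Weyl_inverse)
       (metis lookup_single_eq lookup_zero zero_neq_one)
  then show "(0 :: ('a, 'b) weyl) \<noteq> 1" by metis
qed (simp_all add: weyl_coeffs_inject[symmetric] weyl_coeffs_ops add.assoc add.commute)

end

definition weyl_const :: "'k::zero \<Rightarrow> ('k, 'n::finite) weyl" where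
  "weyl_const c = weyl_monom c 0 0"

definition weyl_x :: "'n \<Rightarrow> ('k::field_char_0, 'n::finite) weyl" where
  "weyl_x j = weyl_monom 1 (axis j 1) 0"

definition weyl_d :: "'n \<Rightarrow> ('k::field_char_0, 'n::finite) weyl" where
  "weyl_d j = weyl_monom 1 0 (axis j 1)"

definition weyl_theta :: "'n \<Rightarrow> ('k::field_char_0, 'n::finite) weyl" where
  "weyl_theta j = weyl_x j * weyl_d j"

definition weyl_d_pow :: "nat ^ 'n \<Rightarrow> ('k::field_char_0, 'n::finite) weyl" where
  "weyl_d_pow u = weyl_monom 1 0 u"

text \<open>
  Sanity checks: the defining relations of the Weyl algebra, and the fact that
  \<^term>\<open>weyl_monom c a b\<close> is the product \<open>c x\<^sup>a \<partial>\<^sup>b\<close>.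
\<close>

lemma weyl_monom_mult:
  "weyl_monom s a b * weyl_monom t c d = Weyl (weyl_monom_times (s * t) a b c d)"
proof -
  have supp: "weyl_supp (weyl_monom r u v) = (if r = 0 then {} else {(u, v)})"
    for r :: 'a and u v :: "nat ^ 'b"
    by (auto simp: in_weyl_supp_iff weyl_coeff_monom split: if_splits)
  show ?thesis
    by (auto simp: times_weyl_def supp weyl_coeff_monom weyl_monom_times_def)
qed

lemma vec_nat_0_eq:
  "{k :: nat ^ 'n. \<forall>j. k $ j = 0 \<and> k $ j \<le> c $ j} = {0}"
  "{k :: nat ^ 'n. \<forall>j. k $ j \<le> c $ j \<and> k $ j = 0} = {0}"
  by (auto simp: vec_eq_iff)

lemma weyl_monom_mult_left: "weyl_monom s a 0 * weyl_monom t c d = weyl_monom (s * t) (a + c) d"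
  unfolding weyl_monom_mult by (simp add: weyl_monom_times_def weyl_monom_def vec_nat_0_eq)

lemma weyl_monom_mult_right: "weyl_monom s a b * weyl_monom t 0 d = weyl_monom (s * t) a (b + d)"
  unfolding weyl_monom_mult by (simp add: weyl_monom_times_def weyl_monom_def vec_nat_0_eq)

lemma weyl_x_commute: "weyl_x i * weyl_x j = weyl_x j * weyl_x i"
  by (simp add: weyl_x_def weyl_monom_mult_left add.commute)

lemma weyl_d_commute: "weyl_d i * weyl_d j = weyl_d j * weyl_d i"
  by (simp add: weyl_d_def weyl_monom_mult_right add.commute)

lemma weyl_const_central: "weyl_const c * P = P * weyl_const c"
proof (rule weyl_act_faithful)
  fix f m
  have c: "pm_act (weyl_coeffs (weyl_const c)) g = (\<lambda>m. c * g m)" for g :: "int ^ 'b \<Rightarrow> 'a"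
    by (simp add: fun_eq_iff weyl_const_def weyl_monom_def Weyl_inverse pm_act_single)
  show "pm_act (weyl_coeffs (weyl_const c * P)) f m = pm_act (weyl_coeffs (P * weyl_const c)) f m"
    unfolding pm_act_times_fun c
    by (simp only: pm_act_def sum_distrib_left case_prod_unfold mult.left_commute)
qed

lemma weyl_d_x_commutator:
  "weyl_d i * weyl_x j - weyl_x j * weyl_d i
    = (if i = j then 1 else (0 :: ('k::field_char_0, 'n::finite) weyl))"
proof -
  let ?e = "\<lambda>i. axis i (1 :: nat) :: nat ^ 'n"
  have ax: "?e i $ l = (if l = i then 1 else 0)" for i l
    by (simp add: axis_def)
  have le: "{k. \<forall>l. k $ l \<le> ?e i $ l \<and> k $ l \<le> ?e j $ l} = (if i = j then {0, ?e i} else {0})"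
    (is "?K = _")
  proof -
    have "k = 0 \<or> (i = j \<and> k = ?e i)" if k: "k \<in> ?K" for k
    proof -
      from k have "k $ l \<le> ?e i $ l" "k $ l \<le> ?e j $ l" for l by blast+
      then have l: "k $ l \<le> (if l = i then 1 else 0)" "k $ l \<le> (if l = j then 1 else 0)" for l
        by (simp_all only: ax)
      have z: "k $ l = 0" if "l \<noteq> i" for l using l(1)[of l] that by simp
      show ?thesis
      proof (cases "k $ i = 0")
        case True
        then have "k $ l = 0" for l using z[of l] by (cases "l = i") auto
        then show ?thesis by (simp add: vec_eq_iff)
      next
        case False
        then have i: "k $ i = 1" "i = j" using l[of i] by (auto split: if_splits)
        have "k $ l = ?e i $ l" for l unfolding ax using z[of l] i(1) by (cases "l = i") auto
        then have "k = ?e i" unfolding vec_eq_iff by blast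
        with i(2) show ?thesis by blast
      qed
    qed
    moreover have "?e i \<in> ?K" if "i = j" using that by simp
    moreover have "0 \<in> ?K" by simp
    ultimately show ?thesis by (cases "i = j") auto
  qed
  have e: "?e i \<noteq> 0" by (simp add: axis_eq_0_iff)
  have p: "(\<Prod>l\<in>UNIV. fact (?e i $ l) * of_nat (?e i $ l choose ?e i $ l)
             * of_nat (?e i $ l choose ?e i $ l)) = (1 :: 'k)"
    by (rule prod.neutral) (auto simp: axis_def)
  have "weyl_d i * weyl_x j
    = weyl_monom 1 (?e j) (?e i) + (if i = j then 1 else (0 :: ('k, 'n) weyl))"
  proof (cases "i = j")
    case True
    have "weyl_monom_times (1 :: 'k) 0 (?e i) (?e j) 0
        = Poly_Mapping.single (?e j, ?e i) 1 + Poly_Mapping.single (0, 0) 1"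
      unfolding weyl_monom_times_def le using True e p by (simp add: add.commute)
    then show ?thesis using True
      unfolding weyl_d_def weyl_x_def weyl_monom_mult
      by (simp add: plus_weyl_def weyl_monom_def one_weyl_def Weyl_inverse)
  next
    case False
    have "weyl_monom_times (1 :: 'k) 0 (?e i) (?e j) 0 = Poly_Mapping.single (?e j, ?e i) 1"
      unfolding weyl_monom_times_def le using False by simp
    then show ?thesis using False
      unfolding weyl_d_def weyl_x_def weyl_monom_mult by (simp add: weyl_monom_def)
  qed
  moreover have "weyl_x j * weyl_d i = (weyl_monom 1 (?e j) (?e i) :: ('k, 'n) weyl)"
    by (simp add: weyl_d_def weyl_x_def weyl_monom_mult_left)
  ultimately show ?thesis by simp
qed

lemma weyl_monom_eq: "weyl_monom c a b = weyl_const c * weyl_monom 1 a 0 * weyl_d_pow b"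
  by (simp add: weyl_const_def weyl_d_pow_def weyl_monom_mult_left)

lemma weyl_monom_x_Suc: "weyl_monom 1 (axis j 1 + a) 0 = weyl_x j * weyl_monom 1 a 0"
  by (simp add: weyl_x_def weyl_monom_mult_left)

lemma weyl_d_pow_Suc: "weyl_d_pow (axis j 1 + b) = weyl_d j * weyl_d_pow b"
  by (simp add: weyl_d_def weyl_d_pow_def weyl_monom_mult_right)


section \<open>Subalgebras and ideals\<close>

text \<open>
  The polynomial rings \<open>k[\<partial>]\<close> and \<open>k[\<theta>]\<close> are the (commutative) \<open>k\<close>-subalgebras of \<open>D\<close> generated
  by the \<open>\<partial>\<^sub>j\<close> and by the \<open>\<theta>\<^sub>j\<close>.
\<close>

definition weyl_subalgebra :: "('k::field_char_0, 'n::finite) weyl set \<Rightarrow> bool" where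
  "weyl_subalgebra R \<longleftrightarrow> range weyl_const \<subseteq> R \<and>
    (\<forall>P\<in>R. \<forall>Q\<in>R. P + Q \<in> R \<and> P * Q \<in> R)"

definition k_partial :: "('k::field_char_0, 'n::finite) weyl set" where
  "k_partial = weyl_subalgebra hull range weyl_d"

definition k_theta :: "('k::field_char_0, 'n::finite) weyl set" where
  "k_theta = weyl_subalgebra hull range weyl_theta"

text \<open>
  \<open>left_ideal R J\<close>: \<open>J\<close> is a left ideal of the subring \<open>R\<close>. For \<open>S \<subseteq> R\<close>, the left ideal
  of \<open>R\<close> generated by \<open>S\<close> is \<open>left_ideal R hull S\<close>.
\<close>

definition left_ideal :: "'a::ring_1 set \<Rightarrow> 'a set \<Rightarrow> bool" where
  "left_ideal R J \<longleftrightarrow> J \<subseteq> R \<and> 0 \<in> J \<and> (\<forall>p\<in>J. \<forall>q\<in>J. p + q \<in> J) \<and> (\<forall>r\<in>R. \<forall>p\<in>J. r * p \<in> J)"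

text \<open>Radical ideals; only used for commutative \<open>R\<close>. The unit ideal is radical.\<close>

definition radical_ideal :: "'a::ring_1 set \<Rightarrow> 'a set \<Rightarrow> bool" where
  "radical_ideal R J \<longleftrightarrow> left_ideal R J \<and> (\<forall>p\<in>R. \<forall>m::nat. p ^ m \<in> J \<longrightarrow> p \<in> J)"


section \<open>Initial ideals\<close>

text \<open>
  The weight of \<open>x\<^sup>a \<partial>\<^sup>b\<close> with respect to \<open>(-w, w)\<close>. On \<open>k[\<partial>]\<close> this is the \<open>w\<close>-weight, so
  \<open>in\<^sub>w\<close> on \<open>k[\<partial>]\<close> and \<open>in\<^bsub>(-w,w)\<^esub>\<close> on \<open>D\<close> are given by one definition. Since \<open>-w + w = 0\<close>, the
  associated graded ring of \<open>D\<close> is \<open>D\<close> itself, and initial forms lie in \<open>D\<close>.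
\<close>

definition weyl_weight :: "real ^ 'n \<Rightarrow> (nat ^ 'n) \<times> (nat ^ 'n) \<Rightarrow> real" where
  "weyl_weight w = (\<lambda>(a, b). \<Sum>j\<in>UNIV. - (w $ j) * real (a $ j) + w $ j * real (b $ j))"

definition initial_form ::
  "real ^ 'n \<Rightarrow> ('k::field_char_0, 'n::finite) weyl \<Rightarrow> ('k, 'n) weyl" where
  "initial_form w P =
    (\<Sum>(a, b) | (a, b) \<in> weyl_supp P \<and>
        (\<forall>t\<in>weyl_supp P. weyl_weight w t \<le> weyl_weight w (a, b)).
      weyl_monom (weyl_coeff P a b) a b)"

definition initial_ideal ::
  "('k::field_char_0, 'n::finite) weyl set \<Rightarrow> real ^ 'n \<Rightarrow> ('k, 'n) weyl set \<Rightarrow> ('k, 'n) weyl set" where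
  "initial_ideal R w J = left_ideal R hull (initial_form w ` J)"


section \<open>Hypergeometric systems\<close>

definition toric_ideal :: "int ^ 'n ^ 'd \<Rightarrow> ('k::field_char_0, 'n::finite) weyl set" where
  "toric_ideal A = left_ideal k_partial hull
    {weyl_d_pow u - weyl_d_pow v | u v. A *v (\<chi> j. int (u $ j)) = A *v (\<chi> j. int (v $ j))}"

definition euler_op ::
  "int ^ 'n ^ 'd \<Rightarrow> 'k ^ 'd \<Rightarrow> 'd \<Rightarrow> ('k::field_char_0, 'n::finite) weyl" where
  "euler_op A \<beta> i = (\<Sum>j\<in>UNIV. weyl_const (of_int (A $ i $ j)) * weyl_theta j) - weyl_const (\<beta> $ i)"

definition hypergeometric_ideal ::
  "int ^ 'n ^ 'd \<Rightarrow> 'k ^ 'd \<Rightarrow> ('k::field_char_0, 'n::finite) weyl set" where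
  "hypergeometric_ideal A \<beta> = left_ideal UNIV hull (toric_ideal A \<union> range (euler_op A \<beta>))"

definition generic_weight ::
  "int ^ 'n::finite ^ 'd \<Rightarrow> ('k::field_char_0) ^ 'd \<Rightarrow> real ^ 'n \<Rightarrow> bool" where
  "generic_weight A \<beta> w \<longleftrightarrow>
    (\<forall>\<^sub>F w' in nhds w.
      initial_ideal k_partial w' (toric_ideal A :: ('k, 'n) weyl set)
        = initial_ideal k_partial w (toric_ideal A) \<and>
      initial_ideal UNIV w' (hypergeometric_ideal A \<beta>)
        = initial_ideal UNIV w (hypergeometric_ideal A \<beta>))"

definition fake_indicial_ideal ::
  "int ^ 'n ^ 'd \<Rightarrow> 'k ^ 'd \<Rightarrow> real ^ 'n \<Rightarrow> ('k::field_char_0, 'n::finite) weyl set" where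
  "fake_indicial_ideal A \<beta> w =
    {P + Q | P Q.
      P \<in> (left_ideal UNIV hull (initial_ideal k_partial w (toric_ideal A))) \<inter> k_theta \<and>
      Q \<in> left_ideal k_theta hull (range (euler_op A \<beta>))}"


section \<open>Point configurations and regular triangulations\<close>

definition real_column :: "int ^ 'n ^ 'd \<Rightarrow> 'n \<Rightarrow> real ^ 'd" where
  "real_column A j = (\<chi> i. real_of_int (A $ i $ j))"

definition conv :: "int ^ 'n ^ 'd \<Rightarrow> (real ^ 'd) set" where
  "conv A = convex hull (range (real_column A))"

definition columns_on_hyperplane :: "int ^ 'n ^ 'd \<Rightarrow> bool" where
  "columns_on_hyperplane A \<longleftrightarrow>
    (\<exists>(h :: rat ^ 'd) (s :: rat). h \<noteq> 0 \<and> s \<noteq> 0 \<and>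
      (\<forall>j. (\<Sum>i\<in>UNIV. h $ i * of_int (A $ i $ j)) = s))"

text \<open>The set of all faces, as subsets of \<open>\<real>\<^sup>d\<close>.\<close>

definition regular_triangulation :: "int ^ 'n ^ 'd \<Rightarrow> real ^ 'n \<Rightarrow> (real ^ 'd) set set" where
  "regular_triangulation A w =
    insert {} {convex hull (real_column A ` I) | I.
      \<exists>c. (\<forall>j\<in>I. c \<bullet> real_column A j = w $ j) \<and> (\<forall>j. j \<notin> I \<longrightarrow> c \<bullet> real_column A j < w $ j)}"

end

theory Submission
  imports Defs
begin

text \<open>
  Let \<open>conv(A)\<close>, as a face of \<open>\<Delta>\<^sub>w\<close>, be spanned by the columns \<open>a\<^sub>i\<close>, \<open>i \<in> I\<close>, with \<open>c \<cdot> a\<^sub>j \<le> w\<^sub>j\<close> and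
  equality exactly for \<open>j \<in> I\<close>. The fake indicial ideal \<open>J\<close> is radical because the quotient
  \<open>k[\<theta>]/J\<close> is a quotient of a finite product of copies of \<open>k\<close>:

  \<^item> For \<open>j \<notin> I\<close> the column \<open>a\<^sub>j\<close> lies in the simplex spanned by the \<open>a\<^sub>i\<close>, so
    \<open>m a\<^sub>j = \<Sum>\<^sub>i p\<^sub>i a\<^sub>i\<close> for some integers \<open>m > 0\<close> and \<open>p\<^sub>i \<ge> 0\<close>
    (\<open>integer_relation_in_simplex\<close>). The binomial \<open>\<partial>\<^sub>j\<^sup>m - \<partial>\<^sup>p\<close> is in \<open>I\<^sub>A\<close>, and its first term has the
    larger weight, so \<open>\<partial>\<^sub>j\<^sup>m \<in> in\<^sub>w(I\<^sub>A)\<close>. Hence \<open>J\<close> contains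
    \<open>x\<^sub>j\<^sup>m \<partial>\<^sub>j\<^sup>m = \<theta>\<^sub>j (\<theta>\<^sub>j - 1) \<cdots> (\<theta>\<^sub>j - m + 1)\<close>, a product of distinct linear factors in
    characteristic zero (\<open>prod_theta_mem_fake_indicial_ideal\<close>).

  \<^item> The columns \<open>a\<^sub>i\<close>, \<open>i \<in> I\<close>, are linearly independent by genericity of \<open>w\<close>
    (\<open>generic_face_independent\<close>), so modulo the Euler operators each \<open>\<theta>\<^sub>i\<close>, \<open>i \<in> I\<close>, is an affine
    function of the \<open>\<theta>\<^sub>j\<close>, \<open>j \<notin> I\<close> (\<open>theta_from_euler\<close>).

  An ideal with these two properties is radical by a split form of Seidenberg's lemma
  (\<open>radical_if_split\<close>).

  The independence rests on the fact that \<open>in\<^sub>w(I\<^sub>A)\<close> contains no monomial supported on \<open>I\<close>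
  (\<open>d_pow_on_face_notin_initial_ideal\<close>): the series \<open>\<Sum> x\<^sup>m / m!\<close>, summed over the \<open>m\<close> with
  support in \<open>I\<close> and \<open>A m = b\<close>, are annihilated by \<open>in\<^sub>w(I\<^sub>A)\<close>, but no such monomial annihilates all
  of them.
\<close>

section \<open>Ideals containing split separable polynomials in the generators\<close>

text \<open>
  A commutative subalgebra \<open>R\<close> of a possibly noncommutative algebra; \<open>C\<close> embeds the scalars. It is
  used for \<open>k[\<theta>]\<close> inside the Weyl algebra.
\<close>

locale comm_subalgebra =
  fixes C :: "'k::field \<Rightarrow> 'a::ring_1" and R :: "'a set"
  assumes C_add: "C (a + b) = C a + C b"
    and C_mult: "C (a * b) = C a * C b"
    and C_1: "C 1 = 1"
    and C_mem: "C c \<in> R"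
    and add_mem: "p \<in> R \<Longrightarrow> q \<in> R \<Longrightarrow> p + q \<in> R"
    and mult_mem: "p \<in> R \<Longrightarrow> q \<in> R \<Longrightarrow> p * q \<in> R"
    and comm: "p \<in> R \<Longrightarrow> q \<in> R \<Longrightarrow> p * q = q * p"
begin

lemma C_0: "C 0 = 0"
  using C_add[of 0 0] by simp

lemma C_minus: "C (- a) = - C a"
  using C_add[of a "- a"] by (simp add: C_0 add_eq_0_iff)

lemma C_diff: "C (a - b) = C a - C b"
  using C_add[of a "- b"] by (simp add: C_minus)

lemma minus_mem: "p \<in> R \<Longrightarrow> - p \<in> R"
  using mult_mem[OF C_mem[of "- 1"], of p] by (simp add: C_minus C_1)

lemma diff_mem: "p \<in> R \<Longrightarrow> q \<in> R \<Longrightarrow> p - q \<in> R"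
  using add_mem[of p "- q"] minus_mem[of q] by simp

lemma power_mem: "p \<in> R \<Longrightarrow> p ^ m \<in> R"
  by (induction m) (use C_mem[of 1] in \<open>auto simp: C_1 intro: mult_mem\<close>)

lemma prod_list_mem: "(\<And>x. x \<in> set xs \<Longrightarrow> f x \<in> R) \<Longrightarrow> prod_list (map f xs) \<in> R"
  by (induction xs) (use C_mem[of 1] in \<open>auto simp: C_1 intro: mult_mem\<close>)

lemma ideal_diff:
  assumes "left_ideal R J" "p \<in> J" "q \<in> J"
  shows "p - q \<in> J"
proof -
  have "p + C (- 1) * q \<in> J"
    using assms C_mem unfolding left_ideal_def by blast
  then show ?thesis by (simp add: C_minus C_1)
qed

lemma ideal_cancel_const:
  assumes "left_ideal R J" "C c * g \<in> J" "c \<noteq> 0"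
  shows "g \<in> J"
proof -
  have "C (inverse c) * (C c * g) \<in> J"
    using assms(1,2) C_mem unfolding left_ideal_def by blast
  then show ?thesis
    using assms(3) by (simp add: mult.assoc[symmetric] C_mult[symmetric] C_1)
qed

text \<open>
  The elements of \<open>R\<close> that act on the class of \<open>e\<close> modulo \<open>J\<close> as a scalar form a subalgebra.
\<close>

lemma scalar_add:
  assumes "left_ideal R J" "(p - C a) * e \<in> J" "(q - C b) * e \<in> J"
  shows "(p + q - C (a + b)) * e \<in> J"
proof -
  have "(p - C a) * e + (q - C b) * e \<in> J"
    using assms unfolding left_ideal_def by blast
  then show ?thesis by (simp add: C_add algebra_simps)
qed

lemma scalar_mult:
  assumes "left_ideal R J" "p \<in> R" "(p - C a) * e \<in> J" "(q - C b) * e \<in> J"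
  shows "(p * q - C (a * b)) * e \<in> J"
proof -
  have "p * ((q - C b) * e) \<in> J" "C b * ((p - C a) * e) \<in> J"
    using assms C_mem unfolding left_ideal_def by blast+
  then have "p * ((q - C b) * e) + C b * ((p - C a) * e) \<in> J"
    using assms(1) unfolding left_ideal_def by blast
  moreover have "C b * C a = C (a * b)" "C b * p = p * C b"
    using comm[OF C_mem[of b] assms(2)] by (simp_all add: C_mult[symmetric] mult.commute)
  moreover have "p * ((q - C b) * e) + C b * ((p - C a) * e)
      = (p * q - C b * C a) * e + (C b * p - p * C b) * e"
    by (simp add: algebra_simps)
  ultimately show ?thesis by simp
qed

lemma scalar_power:
  assumes "left_ideal R J" "p \<in> R" "e \<in> R" "(p - C a) * e \<in> J"
  shows "(p ^ m - C (a ^ m)) * e \<in> J"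
proof (induction m)
  case 0
  then show ?case using assms(1) by (simp add: C_1 left_ideal_def)
next
  case (Suc m)
  then show ?case using scalar_mult[OF assms(1,2,4) Suc] by simp
qed

text \<open>
  If \<open>(y - x) g\<close> lies in \<open>N\<close>, then \<open>\<Prod>\<^sub>t (y - t)\<close> acts on \<open>g\<close> modulo \<open>N\<close> as the scalar
  \<open>\<Prod>\<^sub>t (x - t)\<close>, which is invertible when \<open>x\<close> is none of the \<open>t\<close>.
\<close>

lemma cancel_other_roots:
  assumes "left_ideal R N" "y \<in> R" "(y - C x) * g \<in> N"
    "prod_list (map (\<lambda>t. y - C t) xs) * g \<in> N" "x \<notin> set xs"
  shows "g \<in> N"
proof -
  let ?P = "\<lambda>xs. prod_list (map (\<lambda>t. y - C t) xs)"
  have "(?P xs - C (prod_list (map (\<lambda>t. x - t) xs))) * g \<in> N"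
  proof (induction xs)
    case Nil
    then show ?case using assms(1) by (simp add: C_1 left_ideal_def)
  next
    case (Cons t xs)
    have "(y - C t - C (x - t)) * g \<in> N" using assms(3) by (simp add: C_diff)
    then have "((y - C t) * ?P xs - C ((x - t) * prod_list (map (\<lambda>t. x - t) xs))) * g \<in> N"
      by (intro scalar_mult assms(1) diff_mem assms(2) C_mem Cons)
    then show ?case by simp
  qed
  from ideal_diff[OF assms(1,4) this]
  have "C (prod_list (map (\<lambda>t. x - t) xs)) * g \<in> N" by (simp add: algebra_simps)
  moreover have "prod_list (map (\<lambda>t. x - t) xs) \<noteq> 0"
    using assms(5) by (auto simp: prod_list_zero_iff)
  ultimately show ?thesis using ideal_cancel_const[OF assms(1)] by blast
qed

text \<open>
  When \<open>\<Prod>\<^sub>t (y - t)\<close> with distinct \<open>t\<close> kills \<open>g\<close> modulo \<open>J\<close>, membership of \<open>g\<close> in an ideal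
  \<open>N \<supseteq> J\<close> can be tested on the multiples of \<open>g\<close> on which \<open>y\<close> acts as one of the scalars \<open>t\<close>.
  These multiples replace the Lagrange idempotents of \<open>k[y] / \<langle>\<Prod>\<^sub>t (y - t)\<rangle>\<close>. The set \<open>G\<close> records a
  property inherited by multiples, which need not be stable under sums.
\<close>

lemma mem_from_roots:
  assumes "left_ideal R J" "left_ideal R N" "J \<subseteq> N" "\<And>r h. r \<in> R \<Longrightarrow> h \<in> G \<Longrightarrow> r * h \<in> G" "y \<in> R"
    "\<And>t h. t \<in> set xs \<Longrightarrow> h \<in> G \<Longrightarrow> (y - C t) * h \<in> J \<Longrightarrow> h \<in> N"
    "g \<in> G" "prod_list (map (\<lambda>t. y - C t) xs) * g \<in> J" "distinct xs"
  shows "g \<in> N"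
  using assms(6-9)
proof (induction xs arbitrary: g)
  case Nil
  then show ?case using assms(3) by auto
next
  case (Cons x xs)
  let ?P = "prod_list (map (\<lambda>t. y - C t) xs)"
  have yx: "y - C x \<in> R" and P: "?P \<in> R"
    by (intro diff_mem prod_list_mem C_mem assms(5))+
  have mem: "(y - C x) * g \<in> G" "?P * g \<in> G"
    using assms(4) Cons.prems(2) yx P by blast+
  have kill: "?P * ((y - C x) * g) \<in> J"
    using Cons.prems(3) comm[OF P yx] by (simp add: mult.assoc[symmetric])
  have "(y - C x) * g \<in> N"
  proof (rule Cons.IH[OF _ mem(1), rotated])
    show "h \<in> N" if "t \<in> set xs" "h \<in> G" "(y - C t) * h \<in> J" for t h
      by (rule Cons.prems(1)[of t]) (use that in auto)
  qed (use Cons.prems(4) kill in simp_all)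
  moreover have "?P * g \<in> N"
    by (rule Cons.prems(1)[of x]) (use Cons.prems(3) mem(2) in \<open>simp_all add: mult.assoc\<close>)
  ultimately show ?case
    using cancel_other_roots[OF assms(2,5), of x g xs] Cons.prems(4) by auto
qed

text \<open>
  A form of Seidenberg's lemma for split polynomials: \<open>J\<close> is radical if it contains, for each \<open>j \<in> K\<close>,
  a product of distinct linear factors in \<open>y\<^sub>j\<close>, and if fixing all \<open>y\<^sub>j\<close> to scalars fixes every
  element of \<open>R\<close> to a scalar modulo \<open>J\<close>.
\<close>

lemma radical_if_split:
  fixes y :: "'i \<Rightarrow> 'a"
  assumes J: "left_ideal R J" and "finite K"
    and y: "\<And>j. j \<in> K \<Longrightarrow> y j \<in> R"
    and xs: "\<And>j. j \<in> K \<Longrightarrow> distinct (xs j)"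
      "\<And>j. j \<in> K \<Longrightarrow> prod_list (map (\<lambda>t. y j - C t) (xs j)) \<in> J"
    and gen: "\<And>e r. e \<in> R \<Longrightarrow> r \<in> R \<Longrightarrow> \<forall>j\<in>K. \<exists>c. (y j - C c) * e \<in> J \<Longrightarrow> \<exists>c. (r - C c) * e \<in> J"
  shows "radical_ideal R J"
  unfolding radical_ideal_def
proof (intro conjI J ballI allI impI)
  fix p m assume p: "p \<in> R" "p ^ m \<in> J"
  have J_mult: "r * q \<in> J" if "r \<in> R" "q \<in> J" for r q
    using J that unfolding left_ideal_def by blast
  have J_sub: "q \<in> R" if "q \<in> J" for q
    using J that unfolding left_ideal_def by blast
  \<comment> \<open>The claim is that \<open>1 \<in> N\<close>.\<close>
  define N where "N = {h \<in> R. p * h \<in> J}"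
  have N: "left_ideal R N"
    unfolding left_ideal_def N_def
  proof (intro conjI ballI subsetI; clarsimp?)
    show "0 \<in> R \<and> 0 \<in> J" using J unfolding left_ideal_def by blast
    show "a + b \<in> R \<and> p * (a + b) \<in> J" if "a \<in> R" "p * a \<in> J" "b \<in> R" "p * b \<in> J" for a b
      using J that add_mem unfolding left_ideal_def by (simp add: distrib_left)
    show "r * a \<in> R \<and> p * (r * a) \<in> J" if "r \<in> R" "a \<in> R" "p * a \<in> J" for r a
      using J_mult[OF that(1,3)] comm[OF p(1) that(1)] mult_mem[OF that(1,2)]
      by (simp add: mult.assoc[symmetric])
  qed
  have JN: "J \<subseteq> N" using J_sub J_mult p(1) by (auto simp: N_def)
  \<comment> \<open>\<open>G L\<close>: all \<open>y\<^sub>j\<close> with \<open>j \<notin> L\<close> act on the class of \<open>e\<close> as scalars. Thus \<open>1 \<in> G K\<close>, and on \<open>G {}\<close>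
    everything is scalar; each \<open>l \<in> L\<close> is split off by its roots.\<close>
  define G where "G L = {e \<in> R. \<forall>j\<in>K - L. \<exists>c. (y j - C c) * e \<in> J}" for L
  have G: "r * e \<in> G L" if "r \<in> R" "e \<in> G L" for r e L
  proof -
    have "\<exists>c. (y j - C c) * (r * e) \<in> J" if j: "j \<in> K - L" for j
    proof -
      obtain c where "(y j - C c) * e \<in> J" using \<open>e \<in> G L\<close> j by (auto simp: G_def)
      then have "r * ((y j - C c) * e) \<in> J" using J_mult \<open>r \<in> R\<close> by blast
      moreover have "r * (y j - C c) = (y j - C c) * r"
        using j by (intro comm diff_mem y C_mem \<open>r \<in> R\<close>) auto
      ultimately show ?thesis by (metis mult.assoc)
    qed
    then show ?thesis using that mult_mem by (auto simp: G_def)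
  qed
  have "e \<in> N" if "finite L" "L \<subseteq> K" "e \<in> G L" for e L
    using that
  proof (induction L arbitrary: e rule: finite_induct)
    case empty
    then have e: "e \<in> R" by (simp add: G_def)
    obtain c where c: "(p - C c) * e \<in> J"
      using gen[OF e p(1)] empty by (auto simp: G_def)
    have "(p ^ m - C (c ^ m)) * e \<in> J" by (rule scalar_power[OF J p(1) e c])
    moreover have "p ^ m * e \<in> J" using J_mult[OF e p(2)] comm[OF e power_mem[OF p(1)]] by simp
    ultimately have "C (c ^ m) * e \<in> J"
      using ideal_diff[OF J, of "p ^ m * e" "(p ^ m - C (c ^ m)) * e"] by (simp add: left_diff_distrib)
    then have "c = 0 \<or> e \<in> J"
      using ideal_cancel_const[OF J, of "c ^ m" e] by auto
    then have "p * e \<in> J" using c J_mult p(1) by (auto simp: C_0)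
    with e show ?case by (simp add: N_def)
  next
    case (insert l L)
    then have l: "l \<in> K" "L \<subseteq> K" by auto
    show ?case
    proof (rule mem_from_roots[OF J N JN, where G = "G (insert l L)" and y = "y l" and xs = "xs l"])
      show "h \<in> N" if "h \<in> G (insert l L)" "(y l - C t) * h \<in> J" for t h
        using that by (intro insert.IH l) (auto simp: G_def)
      have "e \<in> R" using insert.prems by (simp add: G_def)
      from J_mult[OF this xs(2)[OF l(1)]] comm[OF this J_sub[OF xs(2)[OF l(1)]]]
      show "prod_list (map (\<lambda>t. y l - C t) (xs l)) * e \<in> J" by simp
    qed (use G insert.prems(2) l(1) y xs(1) in blast)+
  qed
  from this[OF \<open>finite K\<close> order_refl, of 1] have "1 \<in> N"
    using C_mem[of 1] by (auto simp: G_def C_1)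
  then show "p \<in> J" by (simp add: N_def)
qed

end

section \<open>Linear algebra of the columns\<close>

lemma common_denominator:
  fixes f :: "'a \<Rightarrow> rat"
  assumes "finite S"
  shows "\<exists>N::int. N > 0 \<and> (\<forall>x\<in>S. \<exists>z. of_int N * f x = of_int z)"
  using assms
proof (induction S rule: finite_induct)
  case empty
  show ?case by (rule exI[of _ 1]) simp
next
  case (insert a S)
  then obtain N :: int where N: "N > 0" "\<And>x. x \<in> S \<Longrightarrow> \<exists>z. of_int N * f x = of_int z"
    by blast
  obtain p q where pq: "quotient_of (f a) = (p, q)" by fastforce
  then have q: "q > 0" "f a = of_int p / of_int q"
    by (auto intro: quotient_of_denom_pos quotient_of_div)
  have "\<exists>z. of_int (q * N) * f x = of_int z" if x: "x \<in> insert a S" for x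
  proof (cases "x = a")
    case True
    then have "of_int (q * N) * f x = of_int (N * p)" using q by simp
    then show ?thesis by blast
  next
    case False
    then obtain z where "of_int N * f x = of_int z" using N(2) x by blast
    then have "of_int (q * N) * f x = of_int (q * z)" by (simp add: mult.assoc)
    then show ?thesis by blast
  qed
  then show ?case using N(1) q(1) by (intro exI[of _ "q * N"]) auto
qed

text \<open>
  The matrix obtained by stacking \<open>A\<close> on the coordinate rows outside \<open>I\<close> is injective, and the
  first block of a left inverse of it is dual to the columns indexed by \<open>I\<close>.
\<close>

lemma rational_dual:
  fixes A :: "int ^ 'n ^ 'd"
  assumes indep: "\<And>z :: int ^ 'n. (\<forall>j. j \<notin> I \<longrightarrow> z $ j = 0) \<Longrightarrow> A *v z = 0 \<Longrightarrow> z = 0"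
  shows "\<exists>B :: 'n \<Rightarrow> 'd \<Rightarrow> rat. \<forall>i\<in>I. \<forall>j\<in>I.
    (\<Sum>k\<in>UNIV. B i k * of_int (A $ k $ j)) = (if i = j then 1 else 0)"
proof -
  define M :: "rat ^ 'n ^ ('d + 'n)" where
    "M = (\<chi> r. case r of Inl k \<Rightarrow> (\<chi> j. of_int (A $ k $ j))
                    | Inr l \<Rightarrow> (if l \<in> I then 0 else axis l 1))"
  have "q = 0" if "M *v q = 0" for q
  proof -
    have top: "(\<Sum>j\<in>UNIV. of_int (A $ k $ j) * q $ j) = 0" for k
    proof -
      have "(M *v q) $ Inl k = 0" using that by simp
      then show ?thesis by (simp add: matrix_vector_mult_def M_def)
    qed
    have out: "q $ l = 0" if "l \<notin> I" for l
    proof -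
      have "(M *v q) $ Inr l = 0" using \<open>M *v q = 0\<close> by simp
      then have "0 = (\<Sum>j\<in>UNIV. (if j = l then 1 else 0) * q $ j)"
        using that by (simp add: matrix_vector_mult_def M_def axis_def)
      also have "\<dots> = (\<Sum>j\<in>UNIV. if j = l then q $ j else 0)"
        by (rule sum.cong) auto
      finally show ?thesis by simp
    qed
    obtain N where N: "N > 0" "\<forall>j\<in>UNIV. \<exists>z. of_int N * q $ j = of_int z"
      using common_denominator[of UNIV "\<lambda>j. q $ j"] by auto
    then obtain z where z: "\<And>j. of_int N * q $ j = of_int (z j)" by (metis UNIV_I)
    have "(\<chi> j. z j) = (0 :: int ^ 'n)"
    proof (rule indep)
      show "\<forall>j. j \<notin> I \<longrightarrow> (\<chi> j. z j) $ j = (0 :: int)"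
        using z out N(1) by (metis mult_zero_right of_int_eq_0_iff vec_lambda_beta)
      have "(of_int (\<Sum>j\<in>UNIV. A $ k $ j * z j) :: rat) = 0" for k
      proof -
        have "(of_int (\<Sum>j\<in>UNIV. A $ k $ j * z j) :: rat)
            = of_int N * (\<Sum>j\<in>UNIV. of_int (A $ k $ j) * q $ j)"
          by (simp add: z[symmetric] sum_distrib_left algebra_simps)
        then show ?thesis using top by simp
      qed
      then show "A *v (\<chi> j. z j) = 0"
        by (simp only: of_int_eq_0_iff) (simp add: vec_eq_iff matrix_vector_mult_def)
    qed
    then have "z j = 0" for j by (simp add: vec_eq_iff)
    then show "q = 0" using z N(1) by (simp add: vec_eq_iff)
  qed
  then have "\<exists>L. L ** M = mat 1"
    by (simp only: matrix_left_invertible_ker) simp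
  then obtain L where L: "L ** M = mat 1" ..
  have "(\<Sum>k\<in>UNIV. L $ i $ Inl k * of_int (A $ k $ j)) = (if i = j then 1 else 0)"
    if "j \<in> I" for i j
  proof -
    have "(L ** M) $ i $ j = (\<Sum>r\<in>UNIV. L $ i $ r * M $ r $ j)"
      by (simp add: matrix_matrix_mult_def)
    also have "\<dots> = (\<Sum>k\<in>UNIV. L $ i $ Inl k * M $ Inl k $ j)
        + (\<Sum>l\<in>UNIV. L $ i $ Inr l * M $ Inr l $ j)"
      unfolding UNIV_Plus_UNIV[symmetric] by (subst sum.Plus) simp_all
    also have "(\<Sum>l\<in>UNIV. L $ i $ Inr l * M $ Inr l $ j) = 0"
      using that by (intro sum.neutral) (auto simp: M_def axis_def)
    finally have "(\<Sum>k\<in>UNIV. L $ i $ Inl k * M $ Inl k $ j) = (mat 1 :: rat ^ 'n ^ 'n) $ i $ j"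
      by (simp add: L)
    then show ?thesis by (simp add: M_def mat_def)
  qed
  then show ?thesis by (intro exI[of _ "\<lambda>i k. L $ i $ Inl k"]) blast
qed

text \<open>
  The coefficients are indexed by \<open>I\<close> and not by the points, since columns may coincide.
\<close>

lemma convex_hull_image_subset_cone:
  fixes f :: "'i \<Rightarrow> 'a::real_vector"
  assumes "finite I" "x \<in> convex hull (f ` I)"
  shows "\<exists>u. (\<forall>i\<in>I. 0 \<le> u i) \<and> x = (\<Sum>i\<in>I. u i *\<^sub>R f i)"
proof -
  let ?S = "{x. \<exists>u. (\<forall>i\<in>I. 0 \<le> u i) \<and> x = (\<Sum>i\<in>I. u i *\<^sub>R f i)}"
  have "convex hull (f ` I) \<subseteq> ?S"
  proof (rule hull_minimal)
    show "f ` I \<subseteq> ?S"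
    proof (rule image_subsetI)
      fix i assume i: "i \<in> I"
      define u :: "'i \<Rightarrow> real" where "u j = (if j = i then 1 else 0)" for j
      have "(\<Sum>j\<in>I. u j *\<^sub>R f j) = (\<Sum>j\<in>I. if j = i then f i else 0)"
        by (rule sum.cong) (auto simp: u_def)
      then have "f i = (\<Sum>j\<in>I. u j *\<^sub>R f j)" using assms(1) i by simp
      moreover have "\<forall>j\<in>I. 0 \<le> u j" by (simp add: u_def)
      ultimately show "f i \<in> ?S" by blast
    qed
    show "convex ?S"
    proof (rule convexI, clarsimp)
      fix a b :: real and u v :: "'i \<Rightarrow> real"
      assume "0 \<le> a" "0 \<le> b" "\<forall>i\<in>I. 0 \<le> u i" "\<forall>i\<in>I. 0 \<le> v i"
      then show "\<exists>t. (\<forall>i\<in>I. 0 \<le> t i) \<and>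
        a *\<^sub>R (\<Sum>i\<in>I. u i *\<^sub>R f i) + b *\<^sub>R (\<Sum>i\<in>I. v i *\<^sub>R f i) = (\<Sum>i\<in>I. t i *\<^sub>R f i)"
        by (intro exI[of _ "\<lambda>i. a * u i + b * v i"])
           (auto simp: scaleR_sum_right sum.distrib scaleR_add_left)
    qed
  qed
  then show ?thesis using assms(2) by blast
qed

text \<open>
  The barycentric coordinates of a column in the simplex spanned by the columns in \<open>I\<close> are rational,
  because the dual functionals are; clearing denominators gives a relation between monomials.
\<close>

lemma integer_relation_in_simplex:
  fixes A :: "int ^ 'n ^ 'd"
  assumes B: "\<forall>i\<in>I. \<forall>i'\<in>I.
      (\<Sum>k\<in>UNIV. B i k * of_int (A $ k $ i')) = (if i = i' then 1 else (0 :: rat))"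
    and j: "real_column A j \<in> convex hull (real_column A ` I)"
  shows "\<exists>m p. 0 < m \<and> (\<forall>i. i \<notin> I \<longrightarrow> p $ i = 0) \<and> A *v ivec p = A *v ivec (axis j m)"
proof -
  have fin: "finite I" by simp
  obtain u where u: "\<And>i. i \<in> I \<Longrightarrow> 0 \<le> u i"
    and col: "real_column A j = (\<Sum>i\<in>I. u i *\<^sub>R real_column A i)"
    using convex_hull_image_subset_cone[OF fin j] by blast
  have col': "real_of_int (A $ k $ j) = (\<Sum>i\<in>I. u i * real_of_int (A $ k $ i))" for k
    using arg_cong[OF col, of "\<lambda>x. x $ k"] by (simp add: real_column_def)
  define q where "q i = (\<Sum>k\<in>UNIV. B i k * of_int (A $ k $ j))" for i
  have uq: "u i = of_rat (q i)" if i: "i \<in> I" for i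
  proof -
    have "of_rat (q i) = (\<Sum>k\<in>UNIV. of_rat (B i k) * real_of_int (A $ k $ j))"
      by (simp add: q_def of_rat_sum of_rat_mult)
    also have "\<dots> = (\<Sum>k\<in>UNIV. \<Sum>i'\<in>I. u i' * (of_rat (B i k) * real_of_int (A $ k $ i')))"
      by (simp add: col' sum_distrib_left algebra_simps)
    also have "\<dots> = (\<Sum>i'\<in>I. u i' * of_rat (\<Sum>k\<in>UNIV. B i k * of_int (A $ k $ i')))"
      by (subst sum.swap) (simp add: sum_distrib_left of_rat_sum of_rat_mult)
    also have "\<dots> = (\<Sum>i'\<in>I. if i' = i then u i else 0)"
      using B i by (intro sum.cong) auto
    also have "\<dots> = u i" using i by simp
    finally show ?thesis by simp
  qed
  obtain N where N: "N > 0" "\<forall>i\<in>I. \<exists>z. of_int N * q i = of_int z"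
    using common_denominator[OF fin, of q] by blast
  then obtain z where z: "\<And>i. i \<in> I \<Longrightarrow> of_int N * q i = of_int (z i)" by metis
  have Nu: "real_of_int N * u i = real_of_int (z i)" if "i \<in> I" for i
    using arg_cong[OF z[OF that], of "of_rat :: rat \<Rightarrow> real"] uq[OF that]
    by (simp add: of_rat_mult)
  have z0: "0 \<le> z i" if "i \<in> I" for i
  proof -
    have "0 \<le> real_of_int N * u i" using u[OF that] N(1) by simp
    then show ?thesis using Nu[OF that] by simp
  qed
  define p :: "nat ^ 'n" where "p = (\<chi> i. if i \<in> I then nat (z i) else 0)"
  have "(A *v ivec p) $ k = (A *v ivec (axis j (nat N))) $ k" for k
  proof -
    have "real_of_int ((A *v ivec p) $ k)
        = (\<Sum>i\<in>UNIV. if i \<in> I then real_of_int (A $ k $ i) * real_of_int (z i) else 0)"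
      unfolding matrix_vector_mult_def ivec_def p_def
      by (auto intro!: sum.cong simp: z0)
    also have "\<dots> = (\<Sum>i\<in>I. real_of_int (A $ k $ i) * real_of_int (z i))"
      by (simp add: sum.If_cases)
    also have "\<dots> = (\<Sum>i\<in>I. real_of_int N * (u i * real_of_int (A $ k $ i)))"
      by (intro sum.cong) (simp_all add: Nu[symmetric])
    also have "\<dots> = real_of_int (N * A $ k $ j)"
      by (simp add: col' sum_distrib_left)
    also have "N * A $ k $ j = (A *v ivec (axis j (nat N))) $ k"
    proof -
      have "(A *v ivec (axis j (nat N))) $ k
          = (\<Sum>i\<in>UNIV. A $ k $ i * int (if i = j then nat N else 0))"
        by (simp add: matrix_vector_mult_def ivec_def axis_def)
      also have "\<dots> = (\<Sum>i\<in>UNIV. if i = j then A $ k $ i * N else 0)"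
        using N(1) by (intro sum.cong) auto
      finally show ?thesis by simp
    qed
    finally show ?thesis by simp
  qed
  then have "A *v ivec p = A *v ivec (axis j (nat N))" by (simp add: vec_eq_iff)
  moreover have "\<forall>i. i \<notin> I \<longrightarrow> p $ i = 0" by (simp add: p_def)
  ultimately show ?thesis using N(1) by (metis zero_less_nat_eq)
qed

section \<open>Subalgebras and left ideals of the Weyl algebra\<close>

lemma weyl_coeff_ops:
  fixes P Q :: "('k::field_char_0, 'n::finite) weyl"
  shows "weyl_coeff 0 a b = (0 :: 'k)" "weyl_coeff (P + Q) a b = weyl_coeff P a b + weyl_coeff Q a b"
    "weyl_coeff (P - Q) a b = weyl_coeff P a b - weyl_coeff Q a b"
  by (simp_all add: weyl_coeff_def weyl_coeffs_ops lookup_add lookup_minus)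

lemma weyl_coeff_sum:
  fixes P :: "'i \<Rightarrow> ('k::field_char_0, 'n::finite) weyl"
  shows "weyl_coeff (\<Sum>i\<in>S. P i) a b = (\<Sum>i\<in>S. weyl_coeff (P i) a b)"
  by (induction S rule: infinite_finite_induct) (auto simp: weyl_coeff_ops)

lemma weyl_const_0: "weyl_const 0 = (0 :: ('k::field_char_0, 'n::finite) weyl)"
  by (rule weyl_eqI) (simp add: weyl_const_def weyl_coeff_monom weyl_coeff_ops)

lemma zero_mem_subalgebra:
  fixes R :: "('k::field_char_0, 'n::finite) weyl set"
  assumes "weyl_subalgebra R"
  shows "0 \<in> R"
  using assms unfolding weyl_subalgebra_def weyl_const_0[symmetric] by blast

lemma pm_act_diff: "pm_act (p - q) f m = pm_act p f m - pm_act q f m"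
  using pm_act_add[of "p - q" q f m] by simp

lemma weyl_expand:
  fixes P :: "('k::field_char_0, 'n::finite) weyl"
  shows "P = (\<Sum>t\<in>weyl_supp P. weyl_monom (weyl_coeff P (fst t) (snd t)) (fst t) (snd t))"
proof (rule weyl_eqI)
  fix a b
  have "(\<Sum>t\<in>weyl_supp P. weyl_coeff (weyl_monom (weyl_coeff P (fst t) (snd t)) (fst t) (snd t)) a b)
    = (\<Sum>t\<in>weyl_supp P. if t = (a, b) then weyl_coeff P a b else 0)"
    by (rule sum.cong) (auto simp: weyl_coeff_monom)
  also have "\<dots> = weyl_coeff P a b" by (simp add: in_weyl_supp_iff)
  finally show "weyl_coeff P a b = weyl_coeff
      (\<Sum>t\<in>weyl_supp P. weyl_monom (weyl_coeff P (fst t) (snd t)) (fst t) (snd t)) a b"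
    by (simp add: weyl_coeff_sum)
qed

lemma weyl_subalgebra_hull: "weyl_subalgebra (weyl_subalgebra hull S)"
  by (rule hull_in) (auto simp: weyl_subalgebra_def)

lemma weyl_subalgebra_k_partial: "weyl_subalgebra k_partial"
  and weyl_subalgebra_k_theta: "weyl_subalgebra k_theta"
  by (simp_all add: k_partial_def k_theta_def weyl_subalgebra_hull)

lemma weyl_d_pow_mem_k_partial: "weyl_d_pow u \<in> (k_partial :: ('k::field_char_0, 'n::finite) weyl set)"
proof (induction "\<Sum>j\<in>UNIV. u $ j" arbitrary: u)
  case 0
  then have "u = 0" by (simp add: vec_eq_iff)
  then have "weyl_d_pow u = (weyl_const 1 :: ('k, 'n) weyl)"
    by (simp add: weyl_d_pow_def weyl_const_def)
  then show ?case using weyl_subalgebra_k_partial by (auto simp: weyl_subalgebra_def)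
next
  case (Suc s)
  then have "\<exists>j. u $ j \<noteq> 0" by (metis nat.distinct(1) sum.neutral)
  then obtain j where j: "u $ j \<noteq> 0" by blast
  define v where "v = u - axis j 1"
  have u: "u = axis j 1 + v" using j by (simp add: v_def vec_eq_iff axis_def)
  have ul: "u $ l = (if l = j then 1 else 0) + v $ l" for l
    by (simp add: u axis_def)
  have "(\<Sum>l\<in>UNIV. u $ l) = (\<Sum>l\<in>UNIV. (if l = j then 1 else 0) + v $ l)"
    by (rule sum.cong[OF refl]) (rule ul)
  also have "\<dots> = Suc (\<Sum>l\<in>UNIV. v $ l)" by (simp add: sum.distrib)
  finally have "weyl_d_pow v \<in> (k_partial :: ('k, 'n) weyl set)"
    using Suc by simp
  moreover have "weyl_d j \<in> (k_partial :: ('k, 'n) weyl set)"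
    unfolding k_partial_def by (rule hull_inc) simp
  ultimately show ?case
    using weyl_subalgebra_k_partial unfolding u weyl_d_pow_Suc by (auto simp: weyl_subalgebra_def)
qed

text \<open>\<open>k[\<partial>]\<close> consists of the elements whose normally ordered expression contains no \<open>x\<close>.\<close>

lemma weyl_supp_times_no_x:
  fixes P Q :: "('k::field_char_0, 'n::finite) weyl"
  assumes "weyl_supp P \<subseteq> {0} \<times> UNIV" "weyl_supp Q \<subseteq> {0} \<times> UNIV"
  shows "weyl_supp (P * Q) \<subseteq> {0} \<times> UNIV"
proof -
  have "P * Q = (\<Sum>s\<in>weyl_supp P. \<Sum>t\<in>weyl_supp Q.
      weyl_monom (weyl_coeff P (fst s) (snd s)) (fst s) (snd s)
      * weyl_monom (weyl_coeff Q (fst t) (snd t)) (fst t) (snd t))"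
    by (subst weyl_expand[of P], subst weyl_expand[of Q]) (simp add: sum_product)
  also have "\<dots> = (\<Sum>s\<in>weyl_supp P. \<Sum>t\<in>weyl_supp Q.
      weyl_monom (weyl_coeff P (fst s) (snd s) * weyl_coeff Q (fst t) (snd t)) 0 (snd s + snd t))"
  proof (intro sum.cong refl)
    fix s t assume "s \<in> weyl_supp P" "t \<in> weyl_supp Q"
    then have "fst s = 0" "fst t = 0" using assms by auto
    then show "weyl_monom (weyl_coeff P (fst s) (snd s)) (fst s) (snd s)
      * weyl_monom (weyl_coeff Q (fst t) (snd t)) (fst t) (snd t)
      = weyl_monom (weyl_coeff P (fst s) (snd s) * weyl_coeff Q (fst t) (snd t)) 0 (snd s + snd t)"
      by (simp add: weyl_monom_mult_right)
  qed
  finally have "weyl_coeff (P * Q) a b = 0" if "a \<noteq> 0" for a b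
    using that by (simp add: weyl_coeff_sum weyl_coeff_monom)
  then have "a = 0" if "(a, b) \<in> weyl_supp (P * Q)" for a b
    using that unfolding in_weyl_supp_iff by blast
  then show ?thesis by auto
qed

lemma k_partial_no_x:
  assumes "P \<in> (k_partial :: ('k::field_char_0, 'n::finite) weyl set)"
  shows "weyl_supp P \<subseteq> {0} \<times> UNIV"
proof -
  have "k_partial \<subseteq> {P :: ('k, 'n) weyl. weyl_supp P \<subseteq> {0} \<times> UNIV}"
    unfolding k_partial_def
  proof (rule hull_minimal)
    show "range weyl_d \<subseteq> {P :: ('k, 'n) weyl. weyl_supp P \<subseteq> {0} \<times> UNIV}"
      by (auto simp: weyl_d_def in_weyl_supp_iff weyl_coeff_monom split: if_splits)
    show "weyl_subalgebra {P :: ('k, 'n) weyl. weyl_supp P \<subseteq> {0} \<times> UNIV}"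
      unfolding weyl_subalgebra_def
    proof (intro conjI ballI)
      fix P Q :: "('k, 'n) weyl"
      assume PQ: "P \<in> {P. weyl_supp P \<subseteq> {0} \<times> UNIV}" "Q \<in> {P. weyl_supp P \<subseteq> {0} \<times> UNIV}"
      then have "weyl_coeff P a b = 0" "weyl_coeff Q a b = 0" if "a \<noteq> 0" for a b
        using that by (metis (no_types) in_weyl_supp_iff mem_Collect_eq mem_Sigma_iff singletonD subsetD)+
      then have "a = 0" if "(a, b) \<in> weyl_supp (P + Q)" for a b
        using that unfolding in_weyl_supp_iff weyl_coeff_ops by fastforce
      then show "P + Q \<in> {P. weyl_supp P \<subseteq> {0} \<times> UNIV}" by auto
      show "P * Q \<in> {P. weyl_supp P \<subseteq> {0} \<times> UNIV}" using PQ by (simp add: weyl_supp_times_no_x)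
    qed (auto simp: weyl_const_def in_weyl_supp_iff weyl_coeff_monom split: if_splits)
  qed
  then show ?thesis using assms by blast
qed

lemma k_partial_if_no_x:
  fixes P :: "('k::field_char_0, 'n::finite) weyl"
  assumes "weyl_supp P \<subseteq> {0} \<times> UNIV"
  shows "P \<in> k_partial"
proof -
  have sub: "weyl_subalgebra (k_partial :: ('k, 'n) weyl set)" by (rule weyl_subalgebra_k_partial)
  have mon: "weyl_monom (weyl_coeff P (fst t) (snd t)) (fst t) (snd t) \<in> k_partial"
    if "t \<in> weyl_supp P" for t
  proof -
    have "fst t = 0" using that assms by auto
    then have "weyl_monom (weyl_coeff P (fst t) (snd t)) (fst t) (snd t)
        = weyl_const (weyl_coeff P (fst t) (snd t)) * weyl_d_pow (snd t)"
      by (simp add: weyl_const_def weyl_d_pow_def weyl_monom_mult_right)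
    then show ?thesis using sub weyl_d_pow_mem_k_partial by (auto simp: weyl_subalgebra_def)
  qed
  have zero: "(0 :: ('k, 'n) weyl) \<in> k_partial" using sub by (rule zero_mem_subalgebra)
  have "(\<Sum>t\<in>S. weyl_monom (weyl_coeff P (fst t) (snd t)) (fst t) (snd t)) \<in> k_partial"
    if "S \<subseteq> weyl_supp P" for S
    using finite_subset[OF that finite_weyl_supp] that
    by (induction S rule: finite_induct) (use zero mon sub in \<open>auto simp: weyl_subalgebra_def\<close>)
  from this[OF order_refl] show ?thesis by (simp add: weyl_expand[symmetric])
qed

lemma sum_mem_subalgebra:
  fixes R :: "('k::field_char_0, 'n::finite) weyl set"
  assumes "weyl_subalgebra R" "\<And>i. i \<in> S \<Longrightarrow> f i \<in> R"
  shows "sum f S \<in> R"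
  using assms(2)
  by (induction S rule: infinite_finite_induct)
     (use assms(1) zero_mem_subalgebra in \<open>auto simp: weyl_subalgebra_def\<close>)

lemma const_mult_mem_subalgebra: "weyl_subalgebra R \<Longrightarrow> P \<in> R \<Longrightarrow> weyl_const c * P \<in> R"
  by (auto simp: weyl_subalgebra_def)

lemma left_ideal_subalgebra: "weyl_subalgebra R \<Longrightarrow> left_ideal R R"
  using zero_mem_subalgebra by (auto simp: weyl_subalgebra_def left_ideal_def)

text \<open>
  The hypotheses make \<open>R\<close> itself a left ideal containing \<open>S\<close>; without one, the hull would be an
  intersection over the empty family.
\<close>

lemma left_ideal_hull:
  assumes "left_ideal R R" "S \<subseteq> R"
  shows "left_ideal R (left_ideal R hull S)"
  unfolding hull_def left_ideal_def[of R "\<Inter> _"]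
proof (intro conjI ballI)
  show "\<Inter> {t. left_ideal R t \<and> S \<subseteq> t} \<subseteq> R" using assms by blast
qed (auto simp: left_ideal_def)

lemma left_ideal_Int: "left_ideal UNIV J \<Longrightarrow> left_ideal R R \<Longrightarrow> left_ideal R (J \<inter> R)"
  by (auto simp: left_ideal_def)

lemma left_ideal_sum:
  assumes "left_ideal R J1" "left_ideal R J2" "left_ideal R R"
  shows "left_ideal R {P + Q | P Q. P \<in> J1 \<and> Q \<in> J2}"
  unfolding left_ideal_def
proof (intro conjI ballI)
  have sub: "J1 \<subseteq> R" "J2 \<subseteq> R" and zero: "0 \<in> J1" "0 \<in> J2"
    and add: "\<And>p q. p \<in> J1 \<Longrightarrow> q \<in> J1 \<Longrightarrow> p + q \<in> J1" "\<And>p q. p \<in> J2 \<Longrightarrow> q \<in> J2 \<Longrightarrow> p + q \<in> J2"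
      "\<And>p q. p \<in> R \<Longrightarrow> q \<in> R \<Longrightarrow> p + q \<in> R"
    and mult: "\<And>r p. r \<in> R \<Longrightarrow> p \<in> J1 \<Longrightarrow> r * p \<in> J1" "\<And>r p. r \<in> R \<Longrightarrow> p \<in> J2 \<Longrightarrow> r * p \<in> J2"
    using assms by (simp_all add: left_ideal_def)
  let ?J = "{P + Q | P Q. P \<in> J1 \<and> Q \<in> J2}"
  show "?J \<subseteq> R" using sub add(3) by blast
  show "0 \<in> ?J" using zero by force
  fix p assume "p \<in> ?J"
  then obtain P Q where p: "p = P + Q" "P \<in> J1" "Q \<in> J2" by blast
  show "r * p \<in> ?J" if "r \<in> R" for r
    using mult(1)[OF that p(2)] mult(2)[OF that p(3)] unfolding p(1) distrib_left by blast
  show "p + q \<in> ?J" if "q \<in> ?J" for q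
  proof -
    obtain P' Q' where q: "q = P' + Q'" "P' \<in> J1" "Q' \<in> J2" using \<open>q \<in> ?J\<close> by blast
    have "p + q = (P + P') + (Q + Q')" by (simp add: p q algebra_simps)
    then show ?thesis using add(1)[OF p(2) q(2)] add(2)[OF p(3) q(3)] by blast
  qed
qed

text \<open>
  Annihilators in the action on Laurent series are left ideals, so a function killed by the generators
  of a left ideal is killed by all of it.
\<close>

lemma left_ideal_annihilator:
  fixes R :: "('k::field_char_0, 'n::finite) weyl set"
  assumes "weyl_subalgebra R"
  shows "left_ideal R {P \<in> R. \<forall>m. pm_act (weyl_coeffs P) F m = 0}"
proof -
  have "(0 :: ('k, 'n) weyl) \<in> R" using assms by (rule zero_mem_subalgebra)
  moreover have "pm_act (weyl_coeffs (Q * P)) F m = 0"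
    if "\<forall>m. pm_act (weyl_coeffs P) F m = 0" for P Q :: "('k, 'n) weyl" and m
  proof -
    have "pm_act (weyl_coeffs P) F = (\<lambda>m. 0)" using that by auto
    then show ?thesis by (simp add: pm_act_times) (simp add: pm_act_def)
  qed
  ultimately show ?thesis
    using assms unfolding left_ideal_def weyl_subalgebra_def
    by (auto simp: weyl_coeffs_ops pm_act_add)
qed

section \<open>The initial ideal of the toric ideal\<close>

text \<open>
  The series \<open>\<Sum> x\<^sup>m / m!\<close>, summed over the exponents \<open>m \<ge> 0\<close> with support in \<open>T\<close> and \<open>A m = b\<close>, as
  a coefficient function on \<open>\<int>\<^sup>n\<close>. It is a polynomial if the columns of \<open>A\<close> lie on a hyperplane off
  the origin; this is not needed, since the Weyl algebra acts on Laurent series without any support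
  condition.
\<close>

definition truncated_exp ::
  "int ^ 'n ^ 'd \<Rightarrow> 'n set \<Rightarrow> int ^ 'd \<Rightarrow> int ^ 'n \<Rightarrow> 'k::field_char_0" where
  "truncated_exp A T b m =
    (if (\<forall>j. 0 \<le> m $ j) \<and> (\<forall>j. j \<notin> T \<longrightarrow> m $ j = 0) \<and> A *v m = b
     then \<Prod>j\<in>UNIV. inverse (fact (nat (m $ j))) else 0)"

lemma ffall_shift_inverse_fact:
  fixes m :: "int ^ 'n" and u :: "nat ^ 'n"
  assumes "\<forall>j. 0 \<le> m $ j"
  shows "ffall (m + ivec u) u * (\<Prod>j\<in>UNIV. inverse (fact (nat ((m + ivec u) $ j))))
    = (\<Prod>j\<in>UNIV. inverse (fact (nat (m $ j))) :: 'k::field_char_0)"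
  unfolding ffall_def prod.distrib[symmetric]
proof (rule prod.cong, rule refl)
  fix j :: 'n
  obtain k where k: "m $ j = int k" using assms nonneg_int_cases by metis
  have "(fact (u $ j) * of_nat ((k + u $ j) choose (u $ j)) :: 'k) * fact k = fact (k + u $ j)"
  proof -
    have "fact (u $ j) * fact k * ((k + u $ j) choose (u $ j)) = fact (k + u $ j)"
      using binomial_fact_lemma[of "u $ j" "k + u $ j"] by simp
    from arg_cong[OF this, of "of_nat :: nat \<Rightarrow> 'k"] show ?thesis
      by (simp only: of_nat_mult of_nat_fact ac_simps)
  qed
  moreover have "(of_int ((m + ivec u) $ j) gchoose (u $ j)) = (of_nat ((k + u $ j) choose (u $ j)) :: 'k)"
    by (simp add: k ivec_def binomial_gbinomial)
  moreover have "nat ((m + ivec u) $ j) = k + u $ j"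
    by (simp add: k ivec_def nat_add_distrib)
  ultimately show "fact (u $ j) * (of_int ((m + ivec u) $ j) gchoose (u $ j))
      * inverse (fact (nat ((m + ivec u) $ j))) = (inverse (fact (nat (m $ j))) :: 'k)"
    using k by (simp add: field_simps del: vector_add_component)
qed

text \<open>
  If \<open>u\<close> is supported in \<open>T\<close>, then \<open>\<partial>\<^sup>u\<close> maps the series of degree \<open>b\<close> to the one of degree
  \<open>b - A u\<close>; all other \<open>\<partial>\<^sup>u\<close> kill it.
\<close>

lemma d_truncated_exp:
  fixes A :: "int ^ 'n ^ 'd" and u :: "nat ^ 'n"
  shows "ffall (m + ivec u) u * truncated_exp A T b (m + ivec u)
    = (if \<forall>j. j \<notin> T \<longrightarrow> u $ j = 0 then truncated_exp A T (b - A *v ivec u) m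
       else (0 :: 'k::field_char_0))"
proof (cases "\<forall>j. 0 \<le> m $ j")
  case True
  have c1: "(\<forall>j. 0 \<le> (m + ivec u) $ j) \<longleftrightarrow> True" using True by (simp add: ivec_def)
  have c2: "(\<forall>j. j \<notin> T \<longrightarrow> (m + ivec u) $ j = 0)
      \<longleftrightarrow> (\<forall>j. j \<notin> T \<longrightarrow> u $ j = 0) \<and> (\<forall>j. j \<notin> T \<longrightarrow> m $ j = 0)"
  proof -
    have "m $ j + int (u $ j) = 0 \<longleftrightarrow> u $ j = 0 \<and> m $ j = 0" for j
      using True[rule_format, of j] by linarith
    then show ?thesis by (auto simp: ivec_def)
  qed
  have c3: "A *v (m + ivec u) = b \<longleftrightarrow> A *v m = b - A *v ivec u"
    by (auto simp: matrix_vector_right_distrib)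
  have c4: "(\<forall>j. 0 \<le> m $ j) \<longleftrightarrow> True" using True by simp
  note F = ffall_shift_inverse_fact[OF True, of u, where 'k = 'k]
  show ?thesis
    unfolding truncated_exp_def c1 c2 c3 c4
    using F by (smt (verit) mult_zero_right)
next
  case False
  then obtain j where j: "m $ j < 0" by (meson not_le)
  have "ffall (m + ivec u) u * truncated_exp A T b (m + ivec u) = (0 :: 'k)"
  proof (cases "0 \<le> (m + ivec u) $ j")
    case True
    then obtain k where k: "(m + ivec u) $ j = int k" using nonneg_int_cases by metis
    then have "\<not> u $ j \<le> k" using j by (simp add: ivec_def)
    then have "ffall (m + ivec u) u = (0 :: 'k)"
      by (rule ffall_eq_0[where b = "($) u"]) (use k in auto)
    then show ?thesis by simp
  next
    case False
    then show ?thesis by (auto simp: truncated_exp_def)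
  qed
  moreover have "truncated_exp A T (b - A *v ivec u) m = (0 :: 'k)"
    using False by (auto simp: truncated_exp_def)
  ultimately show ?thesis by simp
qed

lemma act_truncated_exp:
  fixes P :: "('k::field_char_0, 'n::finite) weyl" and A :: "int ^ 'n ^ 'd"
  assumes "weyl_supp P \<subseteq> {0} \<times> UNIV"
  shows "pm_act (weyl_coeffs P) (truncated_exp A T b) m
    = (\<Sum>t\<in>weyl_supp P. weyl_coeff P (fst t) (snd t) *
        (if \<forall>j. j \<notin> T \<longrightarrow> snd t $ j = 0 then truncated_exp A T (b - A *v ivec (snd t)) m else 0))"
  unfolding pm_act_def weyl_supp_def[symmetric] weyl_coeff_def[symmetric] case_prod_unfold
proof (rule sum.cong, rule refl)
  fix t assume "t \<in> weyl_supp P"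
  then have "fst t = 0" using assms by auto
  then show "weyl_coeff P (fst t) (snd t) *
      (ffall (m - ivec (fst t) + ivec (snd t)) (snd t) *
       truncated_exp A T b (m - ivec (fst t) + ivec (snd t)))
    = weyl_coeff P (fst t) (snd t) *
        (if \<forall>j. j \<notin> T \<longrightarrow> snd t $ j = 0 then truncated_exp A T (b - A *v ivec (snd t)) m else 0)"
    by (simp add: d_truncated_exp)
qed

lemma weyl_supp_d_pow_diff:
  fixes u v :: "nat ^ 'n"
  shows "weyl_supp (weyl_d_pow u - weyl_d_pow v :: ('k::field_char_0, 'n) weyl) \<subseteq> {(0, u), (0, v)}"
  by (auto simp: in_weyl_supp_iff weyl_coeff_ops weyl_d_pow_def weyl_coeff_monom split: if_splits)

lemma toric_ideal_annihilates:
  fixes P :: "('k::field_char_0, 'n::finite) weyl" and A :: "int ^ 'n ^ 'd"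
  assumes "P \<in> toric_ideal A"
  shows "P \<in> k_partial \<and> (\<forall>m. pm_act (weyl_coeffs P) (truncated_exp A UNIV b) m = 0)"
proof -
  let ?F = "truncated_exp A UNIV b :: int ^ 'n \<Rightarrow> 'k"
  have "toric_ideal A \<subseteq> {P \<in> k_partial. \<forall>m. pm_act (weyl_coeffs P) ?F m = 0}"
    unfolding toric_ideal_def
  proof (rule hull_minimal)
    show "left_ideal k_partial {P \<in> k_partial. \<forall>m. pm_act (weyl_coeffs P) ?F m = 0}"
      by (rule left_ideal_annihilator) (rule weyl_subalgebra_k_partial)
    have "pm_act (weyl_coeffs (weyl_d_pow u)) ?F m = truncated_exp A UNIV (b - A *v ivec u) m" for u m
      using d_truncated_exp[of m u A UNIV b, where 'k = 'k]
      by (simp add: weyl_d_pow_def weyl_monom_def Weyl_inverse pm_act_single)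
    moreover have "weyl_d_pow u - weyl_d_pow v \<in> (k_partial :: ('k, 'n) weyl set)" for u v
      using weyl_supp_d_pow_diff[of u v, where 'k = 'k] by (intro k_partial_if_no_x) blast
    ultimately show "{weyl_d_pow u - weyl_d_pow v | u v.
        A *v (\<chi> j. int (u $ j)) = A *v (\<chi> j. int (v $ j))}
      \<subseteq> {P \<in> k_partial. \<forall>m. pm_act (weyl_coeffs P) ?F m = 0}"
      by (auto simp: weyl_coeffs_ops pm_act_diff ivec_def)
  qed
  then show ?thesis using assms by blast
qed

lemma truncated_exp_at_0: "truncated_exp A T b 0 = (if b = 0 then 1 else (0 :: 'k::field_char_0))"
  by (auto simp: truncated_exp_def)

text \<open>
  Evaluating the previous lemma at the exponent \<open>0\<close>: for every element of \<open>I\<^sub>A\<close>, the coefficients of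
  each degree \<open>b\<close> add up to zero.
\<close>

lemma toric_ideal_coeff_sum:
  fixes P :: "('k::field_char_0, 'n::finite) weyl" and A :: "int ^ 'n ^ 'd"
  assumes "P \<in> toric_ideal A"
  shows "(\<Sum>t | t \<in> weyl_supp P \<and> A *v ivec (snd t) = b. weyl_coeff P (fst t) (snd t)) = 0"
proof -
  have "weyl_supp P \<subseteq> {0} \<times> UNIV"
    using toric_ideal_annihilates[OF assms] by (intro k_partial_no_x) blast
  then have act: "(\<Sum>t\<in>weyl_supp P. weyl_coeff P (fst t) (snd t) *
      truncated_exp A UNIV (b - A *v ivec (snd t)) 0) = 0"
    using toric_ideal_annihilates[OF assms, of b] act_truncated_exp[of P A UNIV b 0] by simp
  have "(\<Sum>t | t \<in> weyl_supp P \<and> A *v ivec (snd t) = b. weyl_coeff P (fst t) (snd t))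
      = (\<Sum>t\<in>weyl_supp P. if A *v ivec (snd t) = b then weyl_coeff P (fst t) (snd t) else 0)"
    by (rule sum.inter_filter) simp
  also have "\<dots> = (\<Sum>t\<in>weyl_supp P. weyl_coeff P (fst t) (snd t) *
      truncated_exp A UNIV (b - A *v ivec (snd t)) 0)"
    by (rule sum.cong) (auto simp: truncated_exp_at_0)
  finally show ?thesis using act by simp
qed

lemma weyl_coeff_initial_form:
  fixes P :: "('k::field_char_0, 'n::finite) weyl"
  shows "weyl_coeff (initial_form w P) a b =
    (if (a, b) \<in> weyl_supp P \<and> (\<forall>t\<in>weyl_supp P. weyl_weight w t \<le> weyl_weight w (a, b))
     then weyl_coeff P a b else 0)"
proof -
  let ?T = "{t. t \<in> weyl_supp P \<and> (\<forall>t'\<in>weyl_supp P. weyl_weight w t' \<le> weyl_weight w t)}"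
  have "weyl_coeff (initial_form w P) a b
    = (\<Sum>t\<in>?T. weyl_coeff (weyl_monom (weyl_coeff P (fst t) (snd t)) (fst t) (snd t)) a b)"
    unfolding initial_form_def weyl_coeff_sum case_prod_unfold by (simp add: case_prod_unfold)
  also have "\<dots> = (\<Sum>t\<in>?T. if t = (a, b) then weyl_coeff P a b else 0)"
    by (rule sum.cong) (auto simp: weyl_coeff_monom)
  also have "\<dots> = (if (a, b) \<in> ?T then weyl_coeff P a b else 0)"
    by (rule sum.delta) simp
  finally show ?thesis by simp
qed

lemma weyl_supp_initial_form:
  fixes P :: "('k::field_char_0, 'n::finite) weyl"
  shows "weyl_supp (initial_form w P)
    = {t \<in> weyl_supp P. \<forall>t'\<in>weyl_supp P. weyl_weight w t' \<le> weyl_weight w t}"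
  by (auto simp: in_weyl_supp_iff weyl_coeff_initial_form split: if_splits)

lemma weight_above_face:
  fixes A :: "int ^ 'n ^ 'd" and u :: "nat ^ 'n" and c :: "real ^ 'd"
  shows "weyl_weight w (0, u) - c \<bullet> (\<chi> k. real_of_int ((A *v ivec u) $ k))
    = (\<Sum>j\<in>UNIV. (w $ j - c \<bullet> real_column A j) * real (u $ j))"
proof -
  have "c \<bullet> (\<chi> k. real_of_int ((A *v ivec u) $ k))
      = (\<Sum>k\<in>UNIV. \<Sum>j\<in>UNIV. c $ k * real_of_int (A $ k $ j) * real (u $ j))"
    by (simp add: inner_vec_def matrix_vector_mult_def ivec_def sum_distrib_left mult.assoc)
  also have "\<dots> = (\<Sum>j\<in>UNIV. (c \<bullet> real_column A j) * real (u $ j))"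
    by (subst sum.swap) (simp add: inner_vec_def real_column_def sum_distrib_right)
  finally show ?thesis
    by (simp add: weyl_weight_def left_diff_distrib sum_subtractf)
qed

text \<open>
  Among the exponents of a given degree, those supported on the face have the least weight, and
  this weight depends on the degree only.
\<close>

lemma weight_minimal_iff:
  fixes A :: "int ^ 'n ^ 'd" and u :: "nat ^ 'n" and c :: "real ^ 'd"
  assumes "\<forall>j\<in>I. c \<bullet> real_column A j = w $ j" "\<forall>j. j \<notin> I \<longrightarrow> c \<bullet> real_column A j < w $ j"
  shows "c \<bullet> (\<chi> k. real_of_int ((A *v ivec u) $ k)) \<le> weyl_weight w (0, u)"
    and "weyl_weight w (0, u) = c \<bullet> (\<chi> k. real_of_int ((A *v ivec u) $ k))
      \<longleftrightarrow> (\<forall>j. j \<notin> I \<longrightarrow> u $ j = 0)"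
proof -
  have nonneg: "0 \<le> (w $ j - c \<bullet> real_column A j) * real (u $ j)" for j
    using assms by (cases "j \<in> I") (auto simp: less_imp_le)
  then show "c \<bullet> (\<chi> k. real_of_int ((A *v ivec u) $ k)) \<le> weyl_weight w (0, u)"
    using weight_above_face[of w u c A] sum_nonneg[of UNIV "\<lambda>j. (w $ j - c \<bullet> real_column A j) * real (u $ j)"]
    by simp
  have "weyl_weight w (0, u) = c \<bullet> (\<chi> k. real_of_int ((A *v ivec u) $ k))
      \<longleftrightarrow> (\<Sum>j\<in>UNIV. (w $ j - c \<bullet> real_column A j) * real (u $ j)) = 0"
    using weight_above_face[of w u c A] by auto
  also have "\<dots> \<longleftrightarrow> (\<forall>j. (w $ j - c \<bullet> real_column A j) * real (u $ j) = 0)"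
    by (subst sum_nonneg_eq_0_iff) (use nonneg in auto)
  also have "\<dots> \<longleftrightarrow> (\<forall>j. j \<notin> I \<longrightarrow> u $ j = 0)"
    using assms by (metis diff_self less_irrefl mult_eq_0_iff of_nat_0 of_nat_eq_0_iff right_minus_eq)
  finally show "weyl_weight w (0, u) = c \<bullet> (\<chi> k. real_of_int ((A *v ivec u) $ k))
      \<longleftrightarrow> (\<forall>j. j \<notin> I \<longrightarrow> u $ j = 0)" .
qed

text \<open>
  The exponents of a given degree that are supported on the face have the least weight in that degree.
  If one of them occurs in \<open>in\<^sub>w(P)\<close>, where only the largest weight of \<open>P\<close> survives, then all exponents
  of this degree occurring in \<open>P\<close> have that same weight, hence lie on the face and occur in
  \<open>in\<^sub>w(P)\<close>; their coefficients add up to zero because \<open>P \<in> I\<^sub>A\<close>.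
\<close>

lemma initial_form_annihilates:
  fixes P :: "('k::field_char_0, 'n::finite) weyl" and A :: "int ^ 'n ^ 'd"
  assumes face: "\<forall>j\<in>I. c \<bullet> real_column A j = w $ j" "\<forall>j. j \<notin> I \<longrightarrow> c \<bullet> real_column A j < w $ j"
    and P: "P \<in> toric_ideal A"
  shows "pm_act (weyl_coeffs (initial_form w P)) (truncated_exp A I b) m = 0"
proof -
  let ?F = "truncated_exp A I :: _ \<Rightarrow> _ \<Rightarrow> 'k"
  let ?Q = "initial_form w P"
  have no_x: "weyl_supp P \<subseteq> {0} \<times> UNIV"
    using toric_ideal_annihilates[OF P] by (intro k_partial_no_x) blast
  then have no_x': "weyl_supp ?Q \<subseteq> {0} \<times> UNIV" by (auto simp: weyl_supp_initial_form)
  let ?b = "b - A *v m"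
  let ?S = "{t \<in> weyl_supp ?Q. (\<forall>j. j \<notin> I \<longrightarrow> snd t $ j = 0) \<and> A *v ivec (snd t) = ?b}"
  have F: "?F (b - A *v ivec (snd t)) m
      = (if A *v ivec (snd t) = ?b then ?F (A *v m) m else 0)" for t :: "(nat ^ 'n) \<times> (nat ^ 'n)"
    by (auto simp: truncated_exp_def algebra_simps)
  have "pm_act (weyl_coeffs ?Q) (?F b) m
      = (\<Sum>t\<in>weyl_supp ?Q. if (\<forall>j. j \<notin> I \<longrightarrow> snd t $ j = 0) \<and> A *v ivec (snd t) = ?b
          then weyl_coeff ?Q (fst t) (snd t) * ?F (A *v m) m else 0)"
    unfolding act_truncated_exp[OF no_x'] F by (rule sum.cong) auto
  also have "\<dots> = (\<Sum>t\<in>?S. weyl_coeff ?Q (fst t) (snd t)) * ?F (A *v m) m"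
    by (subst sum.inter_filter[symmetric]) (simp_all add: sum_distrib_right)
  also have "(\<Sum>t\<in>?S. weyl_coeff ?Q (fst t) (snd t)) = 0"
  proof (cases "?S = {}")
    case True
    then show ?thesis by (simp only: sum.empty)
  next
    case False
    then obtain t0 where t0: "t0 \<in> ?S" by blast
    let ?cb = "c \<bullet> (\<chi> k. real_of_int (?b $ k))"
    have "weyl_weight w (0, snd t0) = ?cb"
      using weight_minimal_iff(2)[OF face, of "snd t0"] t0 by simp
    moreover have "t0 = (0, snd t0)" using t0 no_x' by auto
    ultimately have w0: "weyl_weight w t0 = ?cb" by simp
    have top: "weyl_weight w t \<le> ?cb" if "t \<in> weyl_supp P" for t
      using t0 that w0 by (auto simp: weyl_supp_initial_form)
    have "t \<in> ?S" if t: "t \<in> weyl_supp P" "A *v ivec (snd t) = ?b" for t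
    proof -
      have "t = (0, snd t)" using t(1) no_x by auto
      then have z: "weyl_weight w (0, snd t) = weyl_weight w t" by simp
      have "?cb \<le> weyl_weight w t"
        using weight_minimal_iff(1)[OF face, of "snd t"] unfolding t(2) z .
      then have eq: "weyl_weight w t = ?cb" using top[OF t(1)] by simp
      then have "\<forall>j. j \<notin> I \<longrightarrow> snd t $ j = 0"
        using weight_minimal_iff(2)[OF face, of "snd t"] unfolding t(2) z by blast
      then show ?thesis using t top eq by (simp add: weyl_supp_initial_form)
    qed
    then have S: "?S = {t. t \<in> weyl_supp P \<and> A *v ivec (snd t) = ?b}"
      by (auto simp: weyl_supp_initial_form)
    have "weyl_coeff ?Q (fst t) (snd t) = weyl_coeff P (fst t) (snd t)" if "t \<in> ?S" for t
      using that by (simp add: weyl_supp_initial_form weyl_coeff_initial_form)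
    then have "(\<Sum>t\<in>?S. weyl_coeff ?Q (fst t) (snd t)) = (\<Sum>t\<in>?S. weyl_coeff P (fst t) (snd t))"
      by (intro sum.cong refl)
    then show ?thesis unfolding S using toric_ideal_coeff_sum[OF P] by simp
  qed
  finally show ?thesis by simp
qed

lemma d_pow_on_face_notin_initial_ideal:
  fixes A :: "int ^ 'n ^ 'd"
  assumes face: "\<forall>j\<in>I. c \<bullet> real_column A j = w $ j" "\<forall>j. j \<notin> I \<longrightarrow> c \<bullet> real_column A j < w $ j"
    and u: "\<forall>j. j \<notin> I \<longrightarrow> u $ j = 0"
  shows "(weyl_d_pow u :: ('k::field_char_0, 'n) weyl) \<notin> initial_ideal k_partial w (toric_ideal A)"
proof
  let ?F = "truncated_exp A I (A *v ivec u) :: int ^ 'n \<Rightarrow> 'k"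
  let ?Ann = "{P \<in> k_partial. \<forall>m. pm_act (weyl_coeffs P) ?F m = 0}"
  assume "(weyl_d_pow u :: ('k, 'n) weyl) \<in> initial_ideal k_partial w (toric_ideal A)"
  moreover have "initial_ideal k_partial w (toric_ideal A) \<subseteq> ?Ann"
    unfolding initial_ideal_def
  proof (rule hull_minimal)
    show "left_ideal k_partial ?Ann"
      by (rule left_ideal_annihilator) (rule weyl_subalgebra_k_partial)
    have "initial_form w P \<in> k_partial" if "P \<in> toric_ideal A" for P :: "('k, 'n) weyl"
      using toric_ideal_annihilates[OF that] k_partial_no_x
      by (intro k_partial_if_no_x) (auto simp: weyl_supp_initial_form)
    then show "initial_form w ` toric_ideal A \<subseteq> ?Ann"
      using initial_form_annihilates[OF face] by blast
  qed
  ultimately have "pm_act (weyl_coeffs (weyl_d_pow u)) ?F 0 = 0" by blast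
  moreover have "pm_act (weyl_coeffs (weyl_d_pow u)) ?F 0 = 1"
    using d_truncated_exp[of 0 u A I "A *v ivec u", where 'k = 'k] u
    by (simp add: weyl_d_pow_def weyl_monom_def Weyl_inverse pm_act_single truncated_exp_at_0)
  ultimately show False by simp
qed

lemma d_pow_mem_initial_ideal:
  fixes A :: "int ^ 'n ^ 'd"
  assumes "A *v ivec u = A *v ivec v" "weyl_weight w (0, v) < weyl_weight w (0, u)"
  shows "(weyl_d_pow u :: ('k::field_char_0, 'n) weyl) \<in> initial_ideal k_partial w (toric_ideal A)"
proof -
  let ?P = "weyl_d_pow u - weyl_d_pow v :: ('k, 'n) weyl"
  have uv: "u \<noteq> v" using assms(2) by auto
  then have supp: "weyl_supp ?P = {(0, u), (0, v)}"
    by (auto simp: in_weyl_supp_iff weyl_coeff_ops weyl_d_pow_def weyl_coeff_monom split: if_splits)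
  have "initial_form w ?P = weyl_d_pow u"
  proof (rule weyl_eqI)
    fix a b
    show "weyl_coeff (initial_form w ?P) a b = weyl_coeff (weyl_d_pow u) a b"
      unfolding weyl_coeff_initial_form supp using assms(2) uv
      by (auto simp: weyl_coeff_ops weyl_d_pow_def weyl_coeff_monom)
  qed
  moreover have "?P \<in> toric_ideal A"
    unfolding toric_ideal_def using assms(1) by (intro hull_inc) (auto simp: ivec_def)
  ultimately show ?thesis
    unfolding initial_ideal_def by (intro hull_inc) (metis image_eqI)
qed

text \<open>
  A relation among the columns of the face would give two monomials of equal weight supported on the
  face and of equal degree; perturbing the weight then puts one of them
  into the initial ideal, which is impossible.
\<close>

lemma generic_face_independent:
  fixes A :: "int ^ 'n ^ 'd" and \<beta> :: "'k::field_char_0 ^ 'd"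
  assumes gen: "generic_weight A \<beta> w"
    and face: "\<forall>j\<in>I. c \<bullet> real_column A j = w $ j" "\<forall>j. j \<notin> I \<longrightarrow> c \<bullet> real_column A j < w $ j"
    and z: "\<forall>j. j \<notin> I \<longrightarrow> z $ j = 0" "A *v z = 0"
  shows "z = 0"
proof (rule ccontr)
  assume "z \<noteq> 0"
  define u :: "nat ^ 'n" where "u = (\<chi> j. nat (z $ j))"
  define v :: "nat ^ 'n" where "v = (\<chi> j. nat (- (z $ j)))"
  have zuv: "z = ivec u - ivec v" by (simp add: u_def v_def ivec_def vec_eq_iff)
  have Auv: "A *v ivec u = A *v ivec v"
    using z(2) by (simp add: zuv matrix_vector_mult_diff_distrib)
  have supp: "\<forall>j. j \<notin> I \<longrightarrow> u $ j = 0" "\<forall>j. j \<notin> I \<longrightarrow> v $ j = 0"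
    using z(1) by (simp_all add: u_def v_def)
  have eq: "weyl_weight w (0, u) = weyl_weight w (0, v)"
    using weight_minimal_iff(2)[OF face] supp Auv by metis
  define zr :: "real ^ 'n" where "zr = (\<chi> j. real_of_int (z $ j))"
  have zr: "zr \<noteq> 0" using \<open>z \<noteq> 0\<close> by (simp add: zr_def vec_eq_iff)
  obtain \<delta> where \<delta>: "0 < \<delta>" "\<And>w'. dist w' w < \<delta> \<Longrightarrow>
      initial_ideal k_partial w' (toric_ideal A :: ('k, 'n) weyl set)
        = initial_ideal k_partial w (toric_ideal A)"
    using gen unfolding generic_weight_def eventually_nhds_metric by blast
  define \<epsilon> where "\<epsilon> = \<delta> / (2 * norm zr)"
  have \<epsilon>: "0 < \<epsilon>" using \<delta>(1) zr by (simp add: \<epsilon>_def)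
  \<comment> \<open>Moving \<open>w\<close> in the direction of \<open>u - v\<close> makes \<open>\<partial>\<^sup>u\<close> heavier than \<open>\<partial>\<^sup>v\<close>.\<close>
  define w' where "w' = w + \<epsilon> *\<^sub>R zr"
  have "dist w' w < \<delta>" using \<delta>(1) zr by (simp add: w'_def \<epsilon>_def dist_norm)
  moreover have "weyl_weight w' (0, v) < weyl_weight w' (0, u)"
  proof -
    have diff: "weyl_weight x (0, u) - weyl_weight x (0, v) = x \<bullet> zr" for x :: "real ^ 'n"
      by (simp add: weyl_weight_def inner_vec_def zr_def zuv ivec_def sum_subtractf[symmetric] right_diff_distrib)
    have "w' \<bullet> zr = w \<bullet> zr + \<epsilon> * (zr \<bullet> zr)" by (simp add: w'_def inner_left_distrib)
    moreover have "w \<bullet> zr = 0" using diff[of w] eq by simp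
    moreover have "0 < zr \<bullet> zr" using zr by simp
    ultimately show ?thesis using diff[of w'] \<epsilon> by (smt (verit) mult_pos_pos)
  qed
  ultimately have "(weyl_d_pow u :: ('k, 'n) weyl) \<in> initial_ideal k_partial w (toric_ideal A)"
    using \<delta>(2) d_pow_mem_initial_ideal[OF Auv] by metis
  then show False using d_pow_on_face_notin_initial_ideal[OF face supp(1)] by blast
qed

section \<open>The subalgebra of Euler operators\<close>

text \<open>The elements of \<open>k[\<theta>]\<close> act diagonally on Laurent monomials, hence commute.\<close>

lemma act_theta:
  "pm_act (weyl_coeffs (weyl_theta j)) f m = of_int (m $ j) * (f m :: 'k::field_char_0)"
  and act_x_pow_d_pow:
  "pm_act (weyl_coeffs (weyl_monom 1 (axis j k) (axis j k))) f m
    = (\<Prod>i = 0..<k. of_int (m $ j) - of_nat i) * (f m :: 'k::field_char_0)"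
proof -
  have act: "pm_act (weyl_coeffs (weyl_monom 1 (axis j k) (axis j k))) f m
    = (\<Prod>i = 0..<k. of_int (m $ j) - of_nat i) * (f m :: 'k)" for k
  proof -
    have "ffall m (axis j k) = (\<Prod>l\<in>UNIV. if l = j then fact k * (of_int (m $ j) gchoose k) else (1 :: 'k))"
      unfolding ffall_def by (rule prod.cong) (auto simp: axis_def)
    also have "\<dots> = fact k * (of_int (m $ j) gchoose k)" by simp
    finally show ?thesis
      by (simp add: weyl_monom_def Weyl_inverse pm_act_single gbinomial_mult_fact)
  qed
  show "pm_act (weyl_coeffs (weyl_monom 1 (axis j k) (axis j k))) f m
    = (\<Prod>i = 0..<k. of_int (m $ j) - of_nat i) * (f m :: 'k)" by (rule act)
  show "pm_act (weyl_coeffs (weyl_theta j)) f m = of_int (m $ j) * (f m :: 'k)"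
    using act[of 1] by (simp add: weyl_theta_def weyl_x_def weyl_d_def weyl_monom_mult_left)
qed

lemma act_const: "pm_act (weyl_coeffs (weyl_const c)) f m = c * f m"
  by (simp add: weyl_const_def weyl_monom_def Weyl_inverse pm_act_single)

lemma k_theta_act_diagonal:
  assumes "P \<in> (k_theta :: ('k::field_char_0, 'n::finite) weyl set)"
  shows "\<exists>\<phi>. \<forall>f m. pm_act (weyl_coeffs P) f m = \<phi> m * f m"
proof -
  let ?D = "{P :: ('k, 'n) weyl. \<exists>\<phi>. \<forall>f m. pm_act (weyl_coeffs P) f m = \<phi> m * f m}"
  have "k_theta \<subseteq> ?D"
    unfolding k_theta_def
  proof (rule hull_minimal)
    have "weyl_theta j \<in> ?D" for j
      by (rule CollectI, rule exI[of _ "\<lambda>m. of_int (m $ j)"]) (simp add: act_theta)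
    then show "range weyl_theta \<subseteq> ?D" by blast
    show "weyl_subalgebra ?D"
      unfolding weyl_subalgebra_def
    proof (intro conjI ballI)
      have "weyl_const c \<in> ?D" for c
        by (rule CollectI, rule exI[of _ "\<lambda>m. c"]) (simp add: act_const)
      then show "range weyl_const \<subseteq> ?D" by blast
    next
      fix P Q assume "P \<in> ?D" "Q \<in> ?D"
      then obtain \<phi> \<psi> where "\<And>f m. pm_act (weyl_coeffs P) f m = \<phi> m * f m"
        "\<And>f m. pm_act (weyl_coeffs Q) f m = \<psi> m * f m" by blast
      note PQ = this
      show "P + Q \<in> ?D"
        by (rule CollectI, rule exI[of _ "\<lambda>m. \<phi> m + \<psi> m"])
          (simp add: PQ weyl_coeffs_ops pm_act_add distrib_right)
      show "P * Q \<in> ?D"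
        by (rule CollectI, rule exI[of _ "\<lambda>m. \<phi> m * \<psi> m"])
          (simp add: PQ pm_act_times mult.assoc)
    qed
  qed
  then show ?thesis using assms by blast
qed

interpretation theta: comm_subalgebra weyl_const "k_theta :: ('k::field_char_0, 'n::finite) weyl set"
proof
  fix a b c :: 'k and p q :: "('k, 'n) weyl"
  show "weyl_const (a + b) = (weyl_const a + weyl_const b :: ('k, 'n) weyl)"
    by (rule weyl_eqI) (simp add: weyl_const_def weyl_coeff_ops weyl_coeff_monom)
  show "weyl_const (a * b) = (weyl_const a * weyl_const b :: ('k, 'n) weyl)"
    by (simp add: weyl_const_def weyl_monom_mult_left)
  show "weyl_const 1 = (1 :: ('k, 'n) weyl)" by (simp add: weyl_const_def one_weyl_def)
  have sub: "weyl_subalgebra (k_theta :: ('k, 'n) weyl set)"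
    by (rule weyl_subalgebra_k_theta)
  then show "weyl_const c \<in> (k_theta :: ('k, 'n) weyl set)"
    "p \<in> k_theta \<Longrightarrow> q \<in> k_theta \<Longrightarrow> p + q \<in> k_theta"
    "p \<in> k_theta \<Longrightarrow> q \<in> k_theta \<Longrightarrow> p * q \<in> k_theta"
    unfolding weyl_subalgebra_def by blast+
  show "p * q = q * p" if p: "p \<in> k_theta" and q: "q \<in> k_theta"
  proof -
    obtain \<phi> \<psi> where "\<And>f m. pm_act (weyl_coeffs p) f m = \<phi> m * f m"
      "\<And>f m. pm_act (weyl_coeffs q) f m = \<psi> m * f m"
      using k_theta_act_diagonal[OF p] k_theta_act_diagonal[OF q] by blast
    then show ?thesis
      by (intro weyl_act_faithful) (simp add: pm_act_times)
  qed
qed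

lemma theta_mem: "weyl_theta j \<in> k_theta"
  unfolding k_theta_def by (rule hull_inc) simp

lemma const_sum: "weyl_const (sum f S) = (\<Sum>i\<in>S. weyl_const (f i))"
  by (induction S rule: infinite_finite_induct) (auto simp: theta.C_0 theta.C_add)

lemma euler_op_mem: "euler_op A \<beta> i \<in> k_theta"
  unfolding euler_op_def
  by (intro theta.diff_mem sum_mem_subalgebra weyl_subalgebra_k_theta theta.mult_mem theta.C_mem theta_mem)

lemma x_pow_d_pow_eq_prod_theta:
  "weyl_monom 1 (axis j k) (axis j k)
    = (prod_list (map (\<lambda>t. weyl_theta j - weyl_const t) (map of_nat [0..<k]))
        :: ('k::field_char_0, 'n::finite) weyl)"
proof (rule weyl_act_faithful)
  fix f :: "int ^ 'n \<Rightarrow> 'k" and m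
  have "pm_act (weyl_coeffs (prod_list (map (\<lambda>t. weyl_theta j - weyl_const t) (map of_nat ks)))) f m
      = prod_list (map (\<lambda>i. of_int (m $ j) - of_nat i) ks) * f m" for ks
    by (induction ks)
      (simp_all add: pm_act_one pm_act_times weyl_coeffs_ops pm_act_diff act_theta act_const algebra_simps)
  then show "pm_act (weyl_coeffs (weyl_monom 1 (axis j k) (axis j k))) f m
    = pm_act (weyl_coeffs (prod_list (map (\<lambda>t. weyl_theta j - weyl_const t) (map of_nat [0..<k])))) f m"
    unfolding act_x_pow_d_pow
    using prod.distinct_set_conv_list[of "[0..<k]" "\<lambda>i. of_int (m $ j) - (of_nat i :: 'k)"] by simp
qed

section \<open>The fake indicial ideal\<close>

lemma left_ideal_fake_indicial_ideal: "left_ideal k_theta (fake_indicial_ideal A \<beta> w)"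
  unfolding fake_indicial_ideal_def
proof (rule left_ideal_sum)
  have R: "left_ideal k_theta k_theta"
    by (rule left_ideal_subalgebra) (rule weyl_subalgebra_k_theta)
  show "left_ideal k_theta ((left_ideal UNIV hull initial_ideal k_partial w (toric_ideal A)) \<inter> k_theta)"
    by (intro left_ideal_Int left_ideal_hull R) (auto simp: left_ideal_def)
  show "left_ideal k_theta (left_ideal k_theta hull range (euler_op A \<beta>))"
    by (intro left_ideal_hull R) (auto simp: euler_op_mem)
qed (rule left_ideal_subalgebra, rule weyl_subalgebra_k_theta)

lemma euler_op_mem_fake_indicial_ideal: "euler_op A \<beta> i \<in> fake_indicial_ideal A \<beta> w"
proof -
  have "0 \<in> (left_ideal UNIV hull initial_ideal k_partial w (toric_ideal A)) \<inter> k_theta"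
    using left_ideal_hull[of UNIV] zero_mem_subalgebra[OF weyl_subalgebra_k_theta]
    by (auto simp: left_ideal_def)
  moreover have "euler_op A \<beta> i \<in> left_ideal k_theta hull range (euler_op A \<beta>)"
    by (rule hull_inc) simp
  moreover have "euler_op A \<beta> i = 0 + euler_op A \<beta> i" by simp
  ultimately show ?thesis unfolding fake_indicial_ideal_def by blast
qed

lemma prod_theta_mem_fake_indicial_ideal:
  fixes A :: "int ^ 'n ^ 'd" and \<beta> :: "'k::field_char_0 ^ 'd"
  assumes "(weyl_d_pow (axis j k) :: ('k, 'n) weyl) \<in> initial_ideal k_partial w (toric_ideal A)"
  shows "prod_list (map (\<lambda>t. weyl_theta j - weyl_const t) (map of_nat [0..<k]))
    \<in> fake_indicial_ideal A \<beta> w"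
proof -
  let ?P = "prod_list (map (\<lambda>t. weyl_theta j - weyl_const t) (map of_nat [0..<k])) :: ('k, 'n) weyl"
  let ?M = "left_ideal UNIV hull initial_ideal k_partial w (toric_ideal A) :: ('k, 'n) weyl set"
  have "left_ideal UNIV ?M" by (rule left_ideal_hull) (auto simp: left_ideal_def)
  moreover have "weyl_d_pow (axis j k) \<in> ?M" by (rule hull_inc) (rule assms)
  ultimately have "weyl_monom 1 (axis j k) 0 * weyl_d_pow (axis j k) \<in> ?M"
    unfolding left_ideal_def by blast
  then have "?P \<in> ?M"
    by (simp only: weyl_d_pow_def weyl_monom_mult_left x_pow_d_pow_eq_prod_theta[symmetric]) simp
  moreover have "?P \<in> k_theta"
    by (intro theta.prod_list_mem theta.diff_mem theta_mem theta.C_mem)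
  moreover have "left_ideal k_theta (left_ideal k_theta hull range (euler_op A \<beta>))"
    by (intro left_ideal_hull left_ideal_subalgebra weyl_subalgebra_k_theta) (auto simp: euler_op_mem)
  then have "0 \<in> left_ideal k_theta hull range (euler_op A \<beta>)"
    by (simp only: left_ideal_def)
  moreover have "?P = ?P + 0" by simp
  ultimately show ?thesis unfolding fake_indicial_ideal_def by blast
qed

text \<open>Applying a functional dual to \<open>a\<^sub>i\<close> to the Euler operators solves them for \<open>\<theta>\<^sub>i\<close>.\<close>

lemma theta_from_euler:
  fixes A :: "int ^ 'n ^ 'd" and \<beta> :: "'k::field_char_0 ^ 'd"
  assumes B: "\<forall>j\<in>I. (\<Sum>k\<in>UNIV. B k * of_int (A $ k $ j)) = (if i = j then 1 else (0 :: rat))"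
    and i: "i \<in> I"
  shows "weyl_theta i = (\<Sum>k\<in>UNIV. weyl_const (of_rat (B k)) * (euler_op A \<beta> k + weyl_const (\<beta> $ k)))
    - (\<Sum>j\<in>- I. weyl_const (of_rat (\<Sum>k\<in>UNIV. B k * of_int (A $ k $ j))) * weyl_theta j)"
proof -
  have "(\<Sum>k\<in>UNIV. weyl_const (of_rat (B k)) * (euler_op A \<beta> k + weyl_const (\<beta> $ k)))
      = (\<Sum>k\<in>UNIV. \<Sum>j\<in>UNIV. weyl_const (of_rat (B k * of_int (A $ k $ j)))
          * (weyl_theta j :: ('k, 'n) weyl))"
    by (simp add: euler_op_def sum_distrib_left theta.C_mult of_rat_mult mult.assoc)
  also have "\<dots> = (\<Sum>j\<in>UNIV. weyl_const (of_rat (\<Sum>k\<in>UNIV. B k * of_int (A $ k $ j))) * weyl_theta j)"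
    by (subst sum.swap) (simp add: of_rat_sum const_sum sum_distrib_right)
  also have "\<dots> = (\<Sum>j\<in>I. weyl_const (of_rat (\<Sum>k\<in>UNIV. B k * of_int (A $ k $ j))) * weyl_theta j)
      + (\<Sum>j\<in>- I. weyl_const (of_rat (\<Sum>k\<in>UNIV. B k * of_int (A $ k $ j))) * weyl_theta j)"
    by (simp add: sum.union_disjoint[symmetric])
  also have "(\<Sum>j\<in>I. weyl_const (of_rat (\<Sum>k\<in>UNIV. B k * of_int (A $ k $ j))) * weyl_theta j)
      = (\<Sum>j\<in>I. if j = i then weyl_theta i else (0 :: ('k, 'n) weyl))"
    by (rule sum.cong) (use B in \<open>auto simp: theta.C_0 theta.C_1\<close>)
  also have "\<dots> = weyl_theta i" using i by simp
  finally show ?thesis by simp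
qed

text \<open>
  If the \<open>\<theta>\<^sub>j\<close> with \<open>j \<notin> I\<close> act as scalars on the class of \<open>e\<close>, then so do the remaining \<open>\<theta>\<^sub>i\<close>, hence
  all of \<open>k[\<theta>]\<close>.
\<close>

lemma scalar_mod_fake_indicial_ideal:
  fixes A :: "int ^ 'n ^ 'd" and \<beta> :: "'k::field_char_0 ^ 'd"
    and e r :: "('k, 'n) weyl"
  assumes B: "\<forall>i\<in>I. \<forall>j\<in>I. (\<Sum>k\<in>UNIV. B i k * of_int (A $ k $ j)) = (if i = j then 1 else (0 :: rat))"
    and e: "e \<in> k_theta" and r: "r \<in> k_theta"
    and out: "\<forall>j\<in>- I. \<exists>c. (weyl_theta j - weyl_const c) * e \<in> fake_indicial_ideal A \<beta> w"
  shows "\<exists>c. (r - weyl_const c) * e \<in> fake_indicial_ideal A \<beta> w"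
proof -
  let ?J = "fake_indicial_ideal A \<beta> w :: ('k, 'n) weyl set"
  have J: "left_ideal k_theta ?J" by (rule left_ideal_fake_indicial_ideal)
  define S where "S = {r \<in> k_theta. \<exists>c. (r - weyl_const c) * e \<in> ?J}"
  have sub: "weyl_subalgebra S"
    unfolding weyl_subalgebra_def
  proof (intro conjI ballI)
    have "(weyl_const c - weyl_const c) * e \<in> ?J" for c using J by (simp add: left_ideal_def)
    then have "weyl_const c \<in> S" for c using theta.C_mem unfolding S_def by blast
    then show "range weyl_const \<subseteq> S" by blast
    show "p + q \<in> S" if "p \<in> S" "q \<in> S" for p q
      using that theta.scalar_add[OF J] theta.add_mem unfolding S_def by blast
    show "p * q \<in> S" if "p \<in> S" "q \<in> S" for p q
      using that theta.scalar_mult[OF J] theta.mult_mem unfolding S_def by blast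
  qed
  have euler: "euler_op A \<beta> k \<in> S" for k
  proof -
    have "e * euler_op A \<beta> k \<in> ?J"
      using J e euler_op_mem_fake_indicial_ideal unfolding left_ideal_def by blast
    then have "(euler_op A \<beta> k - weyl_const 0) * e \<in> ?J"
      by (simp add: theta.comm[OF euler_op_mem e] weyl_const_0)
    then show ?thesis using euler_op_mem unfolding S_def by blast
  qed
  have diff: "p - q \<in> S" if "p \<in> S" "q \<in> S" for p q
  proof -
    have "p + weyl_const (- 1) * q \<in> S"
      using that sub unfolding weyl_subalgebra_def by blast
    then show ?thesis by (simp add: theta.C_minus theta.C_1)
  qed
  have theta_out: "weyl_theta j \<in> S" if "j \<in> - I" for j
    using out that theta_mem unfolding S_def by blast
  have "weyl_theta i \<in> S" for i
  proof (cases "i \<in> I")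
    case True
    then have Bi: "\<forall>j\<in>I. (\<Sum>k\<in>UNIV. B i k * of_int (A $ k $ j)) = (if i = j then 1 else (0 :: rat))"
      using B by blast
    have "euler_op A \<beta> k + weyl_const (\<beta> $ k) \<in> S" for k
      using euler[of k] sub unfolding weyl_subalgebra_def by blast
    then show ?thesis
      unfolding theta_from_euler[OF Bi True, of \<beta>]
      by (intro diff sum_mem_subalgebra sub const_mult_mem_subalgebra theta_out)
  qed (use theta_out in blast)
  then have "k_theta \<subseteq> S"
    unfolding k_theta_def using sub by (intro hull_minimal) auto
  then show ?thesis using r unfolding S_def by blast
qed

theorem proposition6p1:
  fixes A :: "int ^ 'n ^ 'd"
    and \<beta> :: "('k::field_char_0) ^ 'd"
    and w :: "real ^ 'n"
  assumes "rank ((\<chi> i j. of_int (A $ i $ j)) :: rat ^ 'n ^ 'd) = CARD('d)"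
    and "columns_on_hyperplane A"
    and "\<exists>m. m simplex (conv A)"
    and "generic_weight A \<beta> w"
    and "regular_triangulation A w = {F. F face_of conv A}"
  shows "radical_ideal k_theta (fake_indicial_ideal A \<beta> w)"
proof -
  have "conv A face_of conv A" by (simp add: conv_def face_of_refl)
  then have "conv A \<in> regular_triangulation A w" using assms(5) by simp
  moreover have "conv A \<noteq> {}" by (simp add: conv_def)
  \<comment> \<open>That \<open>I\<close> only indexes the vertices, each once, is not part of this; genericity will give it.\<close>
  ultimately obtain I c where I: "conv A = convex hull (real_column A ` I)"
    and face: "\<forall>j\<in>I. c \<bullet> real_column A j = w $ j" "\<forall>j. j \<notin> I \<longrightarrow> c \<bullet> real_column A j < w $ j"
    unfolding regular_triangulation_def by blast
  obtain B :: "'n \<Rightarrow> 'd \<Rightarrow> rat" where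
    B: "\<forall>i\<in>I. \<forall>j\<in>I. (\<Sum>k\<in>UNIV. B i k * of_int (A $ k $ j)) = (if i = j then 1 else 0)"
    using rational_dual[of I A] generic_face_independent[OF assms(4) face] by blast
  have "\<exists>m. (weyl_d_pow (axis j m) :: ('k, 'n) weyl) \<in> initial_ideal k_partial w (toric_ideal A)"
    if j: "j \<in> - I" for j
  proof -
    have "real_column A j \<in> convex hull (real_column A ` I)"
      unfolding I[symmetric] conv_def by (rule hull_inc) simp
    from integer_relation_in_simplex[OF B this] obtain m p where
      m: "0 < m" and p: "\<forall>i. i \<notin> I \<longrightarrow> p $ i = 0" "A *v ivec p = A *v ivec (axis j m)" by blast
    have "weyl_weight w (0, p) = c \<bullet> (\<chi> k. real_of_int ((A *v ivec (axis j m)) $ k))"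
      using weight_minimal_iff(2)[OF face, of p] p by simp
    moreover have "weyl_weight w (0, axis j m) \<noteq> c \<bullet> (\<chi> k. real_of_int ((A *v ivec (axis j m)) $ k))"
      using weight_minimal_iff(2)[OF face, of "axis j m"] j m by (auto simp: axis_def)
    ultimately have "weyl_weight w (0, p) < weyl_weight w (0, axis j m)"
      using weight_minimal_iff(1)[OF face, of "axis j m"] by simp
    then show ?thesis using d_pow_mem_initial_ideal[OF p(2)[symmetric]] by blast
  qed
  then obtain M where M: "\<And>j. j \<in> - I \<Longrightarrow>
      (weyl_d_pow (axis j (M j)) :: ('k, 'n) weyl) \<in> initial_ideal k_partial w (toric_ideal A)"
    by metis
  show ?thesis
  proof (rule theta.radical_if_split[where K = "- I" and y = weyl_theta
        and xs = "\<lambda>j. map of_nat [0..<M j]"])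
    show "left_ideal k_theta (fake_indicial_ideal A \<beta> w)" by (rule left_ideal_fake_indicial_ideal)
    show "weyl_theta j \<in> k_theta" for j by (rule theta_mem)
    show "prod_list (map (\<lambda>t. weyl_theta j - weyl_const t) (map of_nat [0..<M j]))
        \<in> fake_indicial_ideal A \<beta> w" if "j \<in> - I" for j
      by (rule prod_theta_mem_fake_indicial_ideal) (rule M[OF that])
    show "distinct (map (of_nat :: nat \<Rightarrow> 'k) [0..<M j])" for j
      by (simp add: distinct_map)
    show "\<exists>c. (r - weyl_const c) * e \<in> fake_indicial_ideal A \<beta> w"
      if "e \<in> k_theta" "r \<in> k_theta"
        "\<forall>j\<in>- I. \<exists>c. (weyl_theta j - weyl_const c) * e \<in> fake_indicial_ideal A \<beta> w" for e r
      using scalar_mod_fake_indicial_ideal[OF B that] .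
  qed simp
qed

end
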